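(* For every finite field $\mathbb F$, Ext-PC over $\mathbb F$ p-simulates Hitting; that is, there is a polynomial-time algorithm that, given a CNF $F$ and a Hitting refutation of $F$, outputs an Ext-PC refutation over $\mathbb F$ of the polynomial translation of $F$.
   Context: A hitting formula is a CNF in which every two distinct clauses contain complementary literals. A Hitting refutation of a CNF $F$ is an unsatisfiable hitting formula $H$ such that every clause $C$ of $H$ has some clause $C'\subseteq C$ belonging to $F$; its size is the number of clauses. Polynomial translation of a CNF $F$ over variables $x_1,\dots,x_n$: introduce dual variables $\bar x_i$; a clause $C$ is translated to the monomial $m_C$ obtained by replacing each negative literal $\bar x_i$ by $x_i$ and each positive literal $x_i$ by $\bar x_i$ and multiplying; the axiom set consists of $m_C$ ($C\in F$), $x_i^2-x_i$, $\bar x_i^2-\bar x_i$ and $x_i+\bar x_i-1$ for all $i$, all interpreted as equations $=0$. Polynomial Calculus (PC) over $\mathbb F$: from polynomials $p,q$ derive $ap+bq$ ($a,b\in\mathbb F$) and $xp$ for any variable $x$; a refutation derives $1$. An Ext-PC refutation of a set $P$ of polynomials is a PC refutation of $P\cup Q$, where $Q=\{y_1-q_1,\dots,y_r-q_r\}$ for new variables $y_j$ and arbitrary polynomials $q_j$ in the original variables and $y_1,\dots,y_{j-1}$; the size is the total number of monomials written in the refutation, including $Q$. *)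

theory Defs
  imports
    "HOL-Library.Poly_Mapping"
    "HOL-Computational_Algebra.Polynomial"
begin

section \<open>CNFs and Hitting refutations\<close>

datatype literal = Pos nat | Neg nat

fun variable :: "literal \<Rightarrow> nat" where
  "variable (Pos i) = i"
| "variable (Neg i) = i"

fun complement :: "literal \<Rightarrow> literal" where
  "complement (Pos i) = Neg i"
| "complement (Neg i) = Pos i"

type_synonym clause = "literal set"
type_synonym cnf = "clause set"

definition cnf_over :: "nat \<Rightarrow> cnf \<Rightarrow> bool" where
  "cnf_over n F \<longleftrightarrow> finite F \<and> (\<forall>C\<in>F. finite C \<and> variable ` C \<subseteq> {1..n})"

fun true_lit :: "(nat \<Rightarrow> bool) \<Rightarrow> literal \<Rightarrow> bool" where
  "true_lit \<alpha> (Pos i) \<longleftrightarrow> \<alpha> i"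
| "true_lit \<alpha> (Neg i) \<longleftrightarrow> \<not> \<alpha> i"

definition satisfies :: "(nat \<Rightarrow> bool) \<Rightarrow> cnf \<Rightarrow> bool" where
  "satisfies \<alpha> F \<longleftrightarrow> (\<forall>C\<in>F. \<exists>l\<in>C. true_lit \<alpha> l)"

definition unsatisfiable :: "cnf \<Rightarrow> bool" where
  "unsatisfiable F \<longleftrightarrow> \<not> (\<exists>\<alpha>. satisfies \<alpha> F)"

definition hitting :: "cnf \<Rightarrow> bool" where
  "hitting H \<longleftrightarrow> (\<forall>C\<in>H. \<forall>D\<in>H. C \<noteq> D \<longrightarrow> (\<exists>l\<in>C. complement l \<in> D))"

definition hitting_refutation :: "nat \<Rightarrow> cnf \<Rightarrow> cnf \<Rightarrow> bool" where
  "hitting_refutation n F H \<longleftrightarrow>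
     cnf_over n H \<and> hitting H \<and> unsatisfiable H \<and> (\<forall>C\<in>H. \<exists>C'\<in>F. C' \<subseteq> C)"


section \<open>Polynomials and the polynomial translation\<close>

text \<open>\<open>X i\<close> is the original variable $x_i$, \<open>XBar i\<close> its dual, and
  \<open>Y j\<close> an extension variable; extension variables are numbered from 0.\<close>

datatype pvar = X nat | XBar nat | Y nat

text \<open>A monomial is its exponent vector; a polynomial is a finitely supported map from
  monomials to coefficients, multiplied by convolution.\<close>

type_synonym 'f mpoly = "(pvar \<Rightarrow>\<^sub>0 nat) \<Rightarrow>\<^sub>0 'f"

definition const_poly :: "'f::field \<Rightarrow> 'f mpoly" where
  "const_poly c = Poly_Mapping.single 0 c"

definition var_poly :: "pvar \<Rightarrow> 'f::field mpoly" where
  "var_poly v = Poly_Mapping.single (Poly_Mapping.single v 1) 1"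

definition poly_vars :: "'f::field mpoly \<Rightarrow> pvar set" where
  "poly_vars p = (\<Union>m\<in>Poly_Mapping.keys p. Poly_Mapping.keys m)"

text \<open>A literal becomes the variable that vanishes exactly when the literal is true.\<close>

fun translate_literal :: "literal \<Rightarrow> pvar" where
  "translate_literal (Pos i) = XBar i"
| "translate_literal (Neg i) = X i"

definition translate_clause :: "clause \<Rightarrow> 'f::field mpoly" where
  "translate_clause C = (\<Prod>l\<in>C. var_poly (translate_literal l))"

definition translate_cnf :: "nat \<Rightarrow> cnf \<Rightarrow> 'f::field mpoly set" where
  "translate_cnf n F =
     translate_clause ` F
     \<union> (\<lambda>i. var_poly (X i) ^ 2 - var_poly (X i)) ` {1..n}
     \<union> (\<lambda>i. var_poly (XBar i) ^ 2 - var_poly (XBar i)) ` {1..n}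
     \<union> (\<lambda>i. var_poly (X i) + var_poly (XBar i) - 1) ` {1..n}"


section \<open>Polynomial Calculus with extension variables\<close>

definition pc_derivation :: "pvar set \<Rightarrow> 'f::field mpoly set \<Rightarrow> 'f mpoly list \<Rightarrow> bool" where
  "pc_derivation V P ls \<longleftrightarrow>
     (\<forall>k<length ls.
        ls ! k \<in> P
      \<or> (\<exists>i<k. \<exists>j<k. \<exists>a b. ls ! k = const_poly a * ls ! i + const_poly b * ls ! j)
      \<or> (\<exists>i<k. \<exists>v\<in>V. ls ! k = var_poly v * ls ! i))"

definition pc_refutation :: "pvar set \<Rightarrow> 'f::field mpoly set \<Rightarrow> 'f mpoly list \<Rightarrow> bool" where
  "pc_refutation V P ls \<longleftrightarrow> pc_derivation V P ls \<and> 1 \<in> set ls"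

definition original_vars :: "nat \<Rightarrow> pvar set" where
  "original_vars n = X ` {1..n} \<union> XBar ` {1..n}"

text \<open>The list \<open>qs\<close> holds the defining polynomials of the extension variables, so that the
  extension axioms are $y_j - q_j$.\<close>

definition ext_pc_refutation ::
    "nat \<Rightarrow> 'f::field mpoly set \<Rightarrow> 'f mpoly list \<Rightarrow> 'f mpoly list \<Rightarrow> bool" where
  "ext_pc_refutation n P qs ls \<longleftrightarrow>
     (\<forall>j<length qs. poly_vars (qs ! j) \<subseteq> original_vars n \<union> Y ` {..<j})
   \<and> pc_refutation (original_vars n \<union> Y ` {..<length qs})
       (P \<union> (\<lambda>j. var_poly (Y j) - qs ! j) ` {..<length qs}) ls"

text \<open>The algorithm has to write a polynomial as an explicit list of terms (coefficient,
  list of variable occurrences); in particular exponents are written in unary. A written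
  refutation consists of the polynomials \<open>qs\<close> and of the proof lines.\<close>

type_synonym 'f written_poly = "('f \<times> pvar list) list"
type_synonym 'f written_refutation = "'f written_poly list \<times> 'f written_poly list"

definition poly_of :: "'f::field written_poly \<Rightarrow> 'f mpoly" where
  "poly_of ts = (\<Sum>(c, vs)\<leftarrow>ts. const_poly c * prod_list (map var_poly vs))"

definition is_ext_pc_refutation ::
    "nat \<Rightarrow> 'f::field mpoly set \<Rightarrow> 'f written_refutation \<Rightarrow> bool" where
  "is_ext_pc_refutation n P R \<longleftrightarrow>
     ext_pc_refutation n P (map poly_of (fst R)) (map poly_of (snd R))"

text \<open>The extra 1 for each \<open>q\<close> is the monomial $y_j$ of the extension axiom $y_j - q_j$.\<close>

definition ext_pc_size :: "'f written_refutation \<Rightarrow> nat" where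
  "ext_pc_size R = (\<Sum>q\<leftarrow>fst R. Suc (length q)) + (\<Sum>p\<leftarrow>snd R. length p)"


section \<open>Polynomial time\<close>

text \<open>Algorithms are programs of a first-order recursive language on binary trees (Neil Jones'
  language F, here with several functions). A program is a list of bodies of one-argument
  functions, of which number 0 is the main function; \<open>Arg\<close> denotes the argument of the
  function being executed. In a condition, \<open>Leaf\<close> means false.

  In \<open>eval P x e v t\<close>, the expression \<open>e\<close> with argument \<open>x\<close> evaluates to \<open>v\<close> in time \<open>t\<close>.
  Each evaluation step is charged the number of nodes of the tree it returns, not a unit
  cost. Without this, sharing would allow trees of exponential size to be built in linear
  time; with it, a multi-tape Turing machine simulates the language with polynomial overhead,
  and conversely, so polynomial time has its usual meaning. In particular, the time bounds
  the size of the output.\<close>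

datatype tree = Leaf | Node tree tree

fun nodes :: "tree \<Rightarrow> nat" where
  "nodes Leaf = 1"
| "nodes (Node l r) = 1 + nodes l + nodes r"

datatype expr =
    Arg
  | Const tree
  | Cons expr expr
  | Left expr
  | Right expr
  | Eq expr expr
  | If expr expr expr
  | Call nat expr

type_synonym program = "expr list"

fun left :: "tree \<Rightarrow> tree" where
  "left Leaf = Leaf"
| "left (Node l r) = l"

fun right :: "tree \<Rightarrow> tree" where
  "right Leaf = Leaf"
| "right (Node l r) = r"

definition tree_of_bool :: "bool \<Rightarrow> tree" where
  "tree_of_bool b = (if b then Node Leaf Leaf else Leaf)"

inductive eval :: "program \<Rightarrow> tree \<Rightarrow> expr \<Rightarrow> tree \<Rightarrow> nat \<Rightarrow> bool" for P :: program where
  Arg: "eval P x Arg x (nodes x)"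
| Const: "eval P x (Const v) v (nodes v)"
| Cons: "eval P x e1 v1 t1 \<Longrightarrow> eval P x e2 v2 t2 \<Longrightarrow>
    eval P x (Cons e1 e2) (Node v1 v2) (t1 + t2 + nodes (Node v1 v2))"
| Left: "eval P x e v t \<Longrightarrow> eval P x (Left e) (left v) (t + nodes (left v))"
| Right: "eval P x e v t \<Longrightarrow> eval P x (Right e) (right v) (t + nodes (right v))"
| Eq: "eval P x e1 v1 t1 \<Longrightarrow> eval P x e2 v2 t2 \<Longrightarrow>
    eval P x (Eq e1 e2) (tree_of_bool (v1 = v2)) (t1 + t2 + nodes (tree_of_bool (v1 = v2)))"
| If_true: "eval P x e v t \<Longrightarrow> v \<noteq> Leaf \<Longrightarrow> eval P x e1 v1 t1 \<Longrightarrow>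
    eval P x (If e e1 e2) v1 (t + t1 + nodes v1)"
| If_false: "eval P x e Leaf t \<Longrightarrow> eval P x e2 v2 t2 \<Longrightarrow>
    eval P x (If e e1 e2) v2 (t + t2 + nodes v2)"
| Call: "eval P x e v t \<Longrightarrow> f < length P \<Longrightarrow> eval P v (P ! f) w s \<Longrightarrow>
    eval P x (Call f e) w (t + s + nodes w)"

definition runs :: "program \<Rightarrow> tree \<Rightarrow> tree \<Rightarrow> nat \<Rightarrow> bool" where
  "runs P x v t \<longleftrightarrow> P \<noteq> [] \<and> eval P x (P ! 0) v t"

lemma eval_deterministic:
  "eval P x e v t \<Longrightarrow> eval P x e v' t' \<Longrightarrow> v' = v \<and> t' = t"
proof (induction arbitrary: v' t' rule: eval.induct)
  case (Arg x)
  then show ?case by cases auto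
next
  case (Const x v)
  then show ?case by cases auto
next
  case (Cons x e1 v1 t1 e2 v2 t2)
  from Cons.prems show ?case by cases (use Cons.IH in blast)+
next
  case (Left x e v t)
  from Left.prems show ?case by cases (use Left.IH in blast)+
next
  case (Right x e v t)
  from Right.prems show ?case by cases (use Right.IH in blast)+
next
  case (Eq x e1 v1 t1 e2 v2 t2)
  from Eq.prems show ?case by cases (use Eq.IH in blast)+
next
  case (If_true x e v t e1 v1 t1 e2)
  from If_true.prems show ?case by cases (use If_true.IH If_true.hyps in blast)+
next
  case (If_false x e t e2 v2 t2 e1)
  from If_false.prems show ?case by cases (use If_false.IH in blast)+
next
  case (Call x e v t f w s)
  from Call.prems show ?case by cases (use Call.IH in blast)+
qed

lemma nodes_le_time: "eval P x e v t \<Longrightarrow> nodes v \<le> t"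
  by (induction rule: eval.induct) auto


section \<open>Encoding of inputs and outputs as trees\<close>

text \<open>Natural numbers are encoded in binary, least significant bit first.\<close>

fun enc_nat :: "nat \<Rightarrow> tree" where
  "enc_nat n = (if n = 0 then Leaf else Node (tree_of_bool (odd n)) (enc_nat (n div 2)))"

declare enc_nat.simps [simp del]

definition enc_list :: "('a \<Rightarrow> tree) \<Rightarrow> 'a list \<Rightarrow> tree" where
  "enc_list enc xs = foldr (\<lambda>x t. Node (enc x) t) xs Leaf"

fun enc_literal :: "literal \<Rightarrow> tree" where
  "enc_literal (Pos i) = Node (tree_of_bool True) (enc_nat i)"
| "enc_literal (Neg i) = Node (tree_of_bool False) (enc_nat i)"

fun enc_pvar :: "pvar \<Rightarrow> tree" where
  "enc_pvar (X i) = Node (enc_nat 0) (enc_nat i)"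
| "enc_pvar (XBar i) = Node (enc_nat 1) (enc_nat i)"
| "enc_pvar (Y j) = Node (enc_nat 2) (enc_nat j)"

text \<open>A CNF is presented to the algorithm as a list of lists of literals, in any order and
  possibly with repetitions.\<close>

definition cnf_of :: "literal list list \<Rightarrow> cnf" where
  "cnf_of cs = set (map set cs)"

definition enc_input :: "nat \<Rightarrow> literal list list \<Rightarrow> literal list list \<Rightarrow> tree" where
  "enc_input n F H =
     Node (enc_nat n)
       (Node (enc_list (enc_list enc_literal) F) (enc_list (enc_list enc_literal) H))"

text \<open>The parameter \<open>num\<close> is a numbering of the field elements.\<close>

definition enc_poly :: "('f \<Rightarrow> nat) \<Rightarrow> 'f written_poly \<Rightarrow> tree" where
  "enc_poly num = enc_list (\<lambda>(c, vs). Node (enc_nat (num c)) (enc_list enc_pvar vs))"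

definition enc_refutation :: "('f \<Rightarrow> nat) \<Rightarrow> 'f written_refutation \<Rightarrow> tree" where
  "enc_refutation num R =
     Node (enc_list (enc_poly num) (fst R)) (enc_list (enc_poly num) (snd R))"

lemma nodes_enc_list: "nodes (enc_list enc xs) = Suc (\<Sum>x\<leftarrow>xs. Suc (nodes (enc x)))"
  by (induction xs) (auto simp: enc_list_def)

text \<open>Together with the previous lemma: an algorithm running in polynomial time outputs
  refutations of polynomial size.\<close>

lemma ext_pc_size_le_nodes: "ext_pc_size R \<le> nodes (enc_refutation num R)"
proof -
  have poly: "length p \<le> nodes (enc_poly num p)" for p
    by (induction p) (auto simp: enc_poly_def enc_list_def)
  have "(\<Sum>q\<leftarrow>qs. Suc (length q)) \<le> nodes (enc_list (enc_poly num) qs)" for qs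
    unfolding nodes_enc_list by (rule le_SucI, rule sum_list_mono) (simp add: poly)
  moreover have "(\<Sum>p\<leftarrow>ps. length p) \<le> nodes (enc_list (enc_poly num) ps)" for ps
    unfolding nodes_enc_list by (rule le_SucI, rule sum_list_mono) (simp add: poly le_SucI)
  ultimately show ?thesis
    unfolding ext_pc_size_def enc_refutation_def by (simp add: add_mono le_SucI)
qed

end

theory Submission
  imports Defs "HOL-Library.Sublist"
begin

text \<open>
  No extension variables are needed. Order the variables, let $Q_{C,k}$ be the part of $m_C$ in the
  variables from the $k$-th on, and call $\sum_C v_C Q_{C,k} - v_\emptyset$ the line of the vector $v$ if it
  vanishes on the Boolean cube. As every assignment falsifies exactly one clause of a hitting refutation,
  $(1, \ldots, 1)$ is such a vector for $k = 1$, and its line together with the $m_C$ gives $1$.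
  A line $p$ follows from its two restrictions by $p = \bar x \, p|_{x=0} + x \, p|_{x=1}$, which are
  lines for $k + 1$. To keep their number below the number of coordinates, all restrictions are
  reduced to an echelon basis of their span at every step, as in the identity test of Raz and Shpilka;
  the reduction steps, reversed, derive the restrictions from the basis. In the end no
  variables are left and all lines are $0$.

  The algorithm is written as a HOL function, and its polynomial running time follows from closure
  properties of the functions that are computable in polynomial time with respect to given encodings.
\<close>

section \<open>Functions computable in polynomial time\<close>

text \<open>That the monomials of a hitting refutation sum to 1 on the cube is a semantic fact; the
  derivation must certify it without running through all assignments, and plain splitting would
  double the number of lines at each variable. What helps is that both restrictions use the same
  stripped monomials: all lines of a level are rows over one list, and their span has dimension at
  most the length of that list, the number of clauses plus one. Elimination could still make
  coefficients grow. Over a finite field their encodings have bounded size and arithmetic is a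
  finite table. The recombination is a polynomial identity only for monomials that contain the split
  variable or its dual. Every other monomial acquires the sum of the pair as a factor, and a
  multiple of the complementarity axiom must take it away. As \<open>polytime\<close> speaks of
  total functions, the size bounds have to hold for arbitrary inputs; they rest on linear algebra
  and not on the hitting property.\<close>

primrec shift :: "nat \<Rightarrow> expr \<Rightarrow> expr" where
  "shift k Arg = Arg"
| "shift k (Const v) = Const v"
| "shift k (Cons e1 e2) = Cons (shift k e1) (shift k e2)"
| "shift k (Left e) = Left (shift k e)"
| "shift k (Right e) = Right (shift k e)"
| "shift k (Eq e1 e2) = Eq (shift k e1) (shift k e2)"
| "shift k (If e e1 e2) = If (shift k e) (shift k e1) (shift k e2)"
| "shift k (Call f e) = Call (f + k) (shift k e)"

text \<open>Prefixing a program by \<open>A\<close> renumbers its functions, so every call, in the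
  expression and in the bodies, moves by \<open>length A\<close>. Values and times stay the same
  because only function numbers change.\<close>

lemma eval_shift:
  "eval P x e v t \<Longrightarrow> eval (A @ map (shift (length A)) P @ B) x (shift (length A) e) v t"
proof (induction rule: eval.induct)
  case (Call x e v t f w s)
  have "(A @ map (shift (length A)) P @ B) ! (f + length A) = shift (length A) (P ! f)"
    using Call.hyps by (simp add: nth_append)
  then show ?case using Call by (auto intro!: eval.Call)
qed (auto intro: eval.intros simp del: nodes.simps)

lemma eval_append: "eval P x e v t \<Longrightarrow> eval (P @ B) x e v t"
proof (induction rule: eval.induct)
  case (Call x e v t f w s)
  then show ?case by (auto intro!: eval.Call simp: nth_append)
qed (auto intro: eval.intros simp del: nodes.simps)

text \<open>The algorithm is an expression inside a program rather than a main function, so that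
  expressions can be nested directly; \<open>polytime_runs\<close> finally turns one into a program
  to be run. All \<open>x\<close> are covered, hence also inputs that encode no refutation.\<close>

definition polytime :: "('a \<Rightarrow> tree) \<Rightarrow> ('b \<Rightarrow> tree) \<Rightarrow> ('a \<Rightarrow> 'b) \<Rightarrow> bool" where
  "polytime ea eb f \<longleftrightarrow> (\<exists>P e (b :: nat poly). \<forall>x. \<exists>t. eval P (ea x) e (eb (f x)) t \<and> t \<le> poly b (nodes (ea x)))"

definition enc_prod :: "('a \<Rightarrow> tree) \<Rightarrow> ('b \<Rightarrow> tree) \<Rightarrow> 'a \<times> 'b \<Rightarrow> tree" where
  "enc_prod ea eb p = Node (ea (fst p)) (eb (snd p))"

lemma poly_nat_mono: "m \<le> n \<Longrightarrow> poly (b :: nat poly) m \<le> poly b n"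
  by (induction b) (auto intro!: add_mono mult_mono)

lemma poly_nat_mono2: "m \<le> n \<Longrightarrow> k \<le> poly (b :: nat poly) m \<Longrightarrow> k \<le> poly b n"
  using poly_nat_mono le_trans by blast

lemma eval_join:
  "\<exists>P k. (\<forall>x e v t. eval P1 x e v t \<longrightarrow> eval P x e v t)
     \<and> (\<forall>x e v t. eval P2 x e v t \<longrightarrow> eval P x (shift k e) v t)"
  using eval_append eval_shift[of P2 _ _ _ _ P1 "[]"] by (metis append_Nil2)

lemma polytime_same_program:
  assumes "polytime ea eb f" "polytime ec ed g"
  obtains P e b e' b' where
    "\<And>x. \<exists>t\<le>poly b (nodes (ea x)). eval P (ea x) e (eb (f x)) t"
    "\<And>x. \<exists>t\<le>poly b' (nodes (ec x)). eval P (ec x) e' (ed (g x)) t"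
proof -
  obtain P1 e1 b1 where 1: "\<And>x. \<exists>t. eval P1 (ea x) e1 (eb (f x)) t \<and> t \<le> poly b1 (nodes (ea x))"
    using assms(1) unfolding polytime_def by blast
  obtain P2 e2 b2 where 2: "\<And>x. \<exists>t. eval P2 (ec x) e2 (ed (g x)) t \<and> t \<le> poly b2 (nodes (ec x))"
    using assms(2) unfolding polytime_def by blast
  obtain P k where
    "\<And>x e v t. eval P1 x e v t \<Longrightarrow> eval P x e v t"
    "\<And>x e v t. eval P2 x e v t \<Longrightarrow> eval P x (shift k e) v t"
    using eval_join[of P1 P2] by blast
  with 1 2 that show ?thesis by meson
qed

lemma bounded_exI: "Q t \<Longrightarrow> t \<le> b \<Longrightarrow> \<exists>t\<le>b. Q (t :: nat)"
  by blast

lemma polytimeI: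
  assumes "\<And>x. \<exists>t\<le>poly b (nodes (ea x)). eval P (ea x) e (eb (f x)) t"
  shows "polytime ea eb f"
  using assms unfolding polytime_def by blast

text \<open>Every evaluation step is charged the size of its result, so a time bound is also a bound
  on the output size.\<close>

lemma polytime_nodes:
  assumes "polytime ea eb f"
  obtains b where "\<And>x. nodes (eb (f x)) \<le> poly b (nodes (ea x))"
  using assms nodes_le_time unfolding polytime_def by (meson le_trans)

section \<open>Closure under constructors, selectors, case distinction and composition\<close>

lemma polytime_id: "polytime ea ea (\<lambda>x. x)"
  by (rule polytimeI[where b = "[:0, 1:]"]) (auto intro: eval.intros)

lemma polytime_const: "polytime ea eb (\<lambda>x. c)"
  by (rule polytimeI[where b = "[:nodes (eb c):]"]) (auto intro: eval.intros)

lemma polytime_left: "polytime ea (\<lambda>x. x) f \<Longrightarrow> polytime ea (\<lambda>x. x) (\<lambda>x. left (f x))"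
proof -
  assume "polytime ea (\<lambda>x. x) f"
  then obtain P e b where 1: "\<And>x. \<exists>t. eval P (ea x) e (f x) t \<and> t \<le> poly b (nodes (ea x))"
    unfolding polytime_def by blast
  show ?thesis
  proof (rule polytimeI[where b = "b + b" and P = P])
    fix x
    obtain t where t: "eval P (ea x) e (f x) t" "t \<le> poly b (nodes (ea x))"
      using 1 by blast
    have "nodes (left (f x)) \<le> nodes (f x)" by (cases "f x") auto
    with t nodes_le_time[OF t(1)] eval.Left[OF t(1)]
    show "\<exists>t\<le>poly (b + b) (nodes (ea x)). eval P (ea x) (Left e) (left (f x)) t"
      by (intro exI[of _ "t + nodes (left (f x))"]) simp
  qed
qed

lemma polytime_right: "polytime ea (\<lambda>x. x) f \<Longrightarrow> polytime ea (\<lambda>x. x) (\<lambda>x. right (f x))"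
proof -
  assume "polytime ea (\<lambda>x. x) f"
  then obtain P e b where 1: "\<And>x. \<exists>t. eval P (ea x) e (f x) t \<and> t \<le> poly b (nodes (ea x))"
    unfolding polytime_def by blast
  show ?thesis
  proof (rule polytimeI[where b = "b + b" and P = P])
    fix x
    obtain t where t: "eval P (ea x) e (f x) t" "t \<le> poly b (nodes (ea x))"
      using 1 by blast
    have "nodes (right (f x)) \<le> nodes (f x)" by (cases "f x") auto
    with t nodes_le_time[OF t(1)] eval.Right[OF t(1)]
    show "\<exists>t\<le>poly (b + b) (nodes (ea x)). eval P (ea x) (Right e) (right (f x)) t"
      by (intro exI[of _ "t + nodes (right (f x))"]) simp
  qed
qed

lemma polytime_cong:
  "polytime ea eb f \<Longrightarrow> (\<And>x. eb (f x) = eb' (f' x)) \<Longrightarrow> polytime ea eb' f'"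
  unfolding polytime_def by simp

text \<open>Only the encoded result occurs in \<open>polytime\<close>. Regarding it as a bare tree
  makes \<open>left\<close>, \<open>right\<close> and comparison with a constant tree available for
  any encoding.\<close>

lemma polytime_tree: "polytime ea eb f \<longleftrightarrow> polytime ea (\<lambda>x. x) (\<lambda>x. eb (f x))"
  unfolding polytime_def by simp

lemma polytime_fst: "polytime ea (enc_prod eb ec) f \<Longrightarrow> polytime ea eb (\<lambda>x. fst (f x))"
  by (subst polytime_tree, rule polytime_cong[OF polytime_left[OF polytime_tree[THEN iffD1]]])
     (auto simp: enc_prod_def)

lemma polytime_snd: "polytime ea (enc_prod eb ec) f \<Longrightarrow> polytime ea ec (\<lambda>x. snd (f x))"
  by (subst polytime_tree, rule polytime_cong[OF polytime_right[OF polytime_tree[THEN iffD1]]])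
     (auto simp: enc_prod_def)

lemma polytime_Node:
  assumes "polytime ea eb f" "polytime ea ec g" "\<And>x. ed (h x) = Node (eb (f x)) (ec (g x))"
  shows "polytime ea ed h"
proof -
  obtain P e b e' b' where
    1: "\<And>x. \<exists>t\<le>poly b (nodes (ea x)). eval P (ea x) e (eb (f x)) t" and
    2: "\<And>x. \<exists>t\<le>poly b' (nodes (ea x)). eval P (ea x) e' (ec (g x)) t"
    using polytime_same_program[OF assms(1,2)] by metis
  show ?thesis
  proof (rule polytimeI[where b = "b + b' + b + b' + 1" and P = P])
    fix x
    obtain t t' where t: "t\<le>poly b (nodes (ea x))" "eval P (ea x) e (eb (f x)) t"
       "t'\<le>poly b' (nodes (ea x))" "eval P (ea x) e' (ec (g x)) t'"
      using 1 2 by meson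
    with nodes_le_time[OF t(2)] nodes_le_time[OF t(4)] eval.Cons[OF t(2) t(4)]
    show "\<exists>t\<le>poly (b + b' + b + b' + 1) (nodes (ea x)). eval P (ea x) (Cons e e') (ed (h x)) t"
      unfolding assms(3) by (intro exI conjI) auto
  qed
qed

lemma polytime_Pair:
  "polytime ea eb f \<Longrightarrow> polytime ea ec g \<Longrightarrow> polytime ea (enc_prod eb ec) (\<lambda>x. (f x, g x))"
  by (rule polytime_Node[where eb = eb and ec = ec and f = f and g = g]) (auto simp: enc_prod_def)

lemma enc_list_simps [simp]:
  "enc_list e [] = Leaf" "enc_list e (x # xs) = Node (e x) (enc_list e xs)"
  by (auto simp: enc_list_def)

lemma polytime_Cons:
  "polytime ea eb f \<Longrightarrow> polytime ea (enc_list eb) g \<Longrightarrow> polytime ea (enc_list eb) (\<lambda>x. f x # g x)"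
  by (rule polytime_Node[where eb = eb and ec = "enc_list eb" and f = f and g = g]) auto

lemma nodes_tree_of_bool [simp]: "nodes (tree_of_bool b) \<le> 3"
  by (simp add: tree_of_bool_def)

lemma polytime_eq:
  assumes "polytime ea eb f" "polytime ea eb g" "inj eb"
  shows "polytime ea tree_of_bool (\<lambda>x. f x = g x)"
proof -
  obtain P e b e' b' where
    1: "\<And>x. \<exists>t\<le>poly b (nodes (ea x)). eval P (ea x) e (eb (f x)) t" and
    2: "\<And>x. \<exists>t\<le>poly b' (nodes (ea x)). eval P (ea x) e' (eb (g x)) t"
    using polytime_same_program[OF assms(1,2)] by metis
  show ?thesis
  proof (rule polytimeI[where b = "b + b' + 3" and P = P])
    fix x
    obtain t t' where t: "t\<le>poly b (nodes (ea x))" "eval P (ea x) e (eb (f x)) t"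
       "t'\<le>poly b' (nodes (ea x))" "eval P (ea x) e' (eb (g x)) t'"
      using 1 2 by meson
    have "(eb (f x) = eb (g x)) = (f x = g x)" using assms(3) by (auto dest: injD)
    with t nodes_tree_of_bool[of "f x = g x"] eval.Eq[OF t(2) t(4)]
    show "\<exists>t\<le>poly (b + b' + 3) (nodes (ea x)). eval P (ea x) (Eq e e') (tree_of_bool (f x = g x)) t"
      by (intro exI conjI) (auto intro!: add_mono)
  qed
qed

text \<open>Both branches are evaluated as one pair and the condition selects a component. Thus only
  two programs have to be joined, at the price of running both branches.\<close>

lemma polytime_if:
  assumes "polytime ea tree_of_bool c" "polytime ea eb f" "polytime ea eb g"
  shows "polytime ea eb (\<lambda>x. if c x then f x else g x)"
proof -
  have p: "polytime ea (enc_prod eb eb) (\<lambda>x. (f x, g x))" by (intro polytime_Pair assms)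
  obtain P e b e' b' where
    1: "\<And>x. \<exists>t\<le>poly b (nodes (ea x)). eval P (ea x) e (tree_of_bool (c x)) t" and
    2: "\<And>x. \<exists>t\<le>poly b' (nodes (ea x)). eval P (ea x) e' (enc_prod eb eb (f x, g x)) t"
    using polytime_same_program[OF assms(1) p] by metis
  show ?thesis
  proof (rule polytimeI[where b = "b + b' + b' + b'" and P = P])
    fix x
    obtain t t' where t: "t\<le>poly b (nodes (ea x))" "eval P (ea x) e (tree_of_bool (c x)) t"
       "t'\<le>poly b' (nodes (ea x))" "eval P (ea x) e' (Node (eb (f x)) (eb (g x))) t'"
      using 1 2 unfolding enc_prod_def fst_conv snd_conv by meson
    have l: "eval P (ea x) (Left e') (eb (f x)) (t' + nodes (eb (f x)))"
      and r: "eval P (ea x) (Right e') (eb (g x)) (t' + nodes (eb (g x)))"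
      using eval.Left[OF t(4)] eval.Right[OF t(4)] by auto
    show "\<exists>t\<le>poly (b + b' + b' + b') (nodes (ea x)).
        eval P (ea x) (If e (Left e') (Right e')) (eb (if c x then f x else g x)) t"
    proof (cases "c x")
      case True
      with t(2) have "tree_of_bool (c x) \<noteq> Leaf" by (simp add: tree_of_bool_def)
      from eval.If_true[OF t(2) this l] True nodes_le_time[OF t(4)] t show ?thesis
        by (intro exI[of _ "t + (t' + nodes (eb (f x))) + nodes (eb (f x))"] conjI) auto
    next
      case False
      have "eval P (ea x) e Leaf t" using t(2) False by (simp add: tree_of_bool_def)
      from eval.If_false[OF this r] False nodes_le_time[OF t(4)] t show ?thesis
        by (intro exI[of _ "t + (t' + nodes (eb (g x))) + nodes (eb (g x))"] conjI) auto
    qed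
  qed
qed

text \<open>The expression for \<open>f\<close> becomes a new function at the end of the program,
  called on the value of \<open>g\<close>. Its time is bounded in the size of \<open>g x\<close>,
  which is at most the time for \<open>g\<close>; hence \<open>pcompose b b'\<close>.\<close>

lemma polytime_comp:
  assumes "polytime eb ec f" "polytime ea eb g"
  shows "polytime ea ec (\<lambda>x. f (g x))"
proof -
  obtain P e b e' b' where
    1: "\<And>x. \<exists>t\<le>poly b (nodes (eb x)). eval P (eb x) e (ec (f x)) t" and
    2: "\<And>x. \<exists>t\<le>poly b' (nodes (ea x)). eval P (ea x) e' (eb (g x)) t"
    using polytime_same_program[OF assms(1,2)] by metis
  show ?thesis
  proof (rule polytimeI[where b = "b' + pcompose b b' + pcompose b b'" and P = "P @ [e]"])
    fix x
    obtain t t' where t: "t\<le>poly b (nodes (eb (g x)))" "eval P (eb (g x)) e (ec (f (g x))) t"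
       "t'\<le>poly b' (nodes (ea x))" "eval P (ea x) e' (eb (g x)) t'"
      using 1 2 by meson
    have "nodes (eb (g x)) \<le> poly b' (nodes (ea x))" using nodes_le_time[OF t(4)] t(3) by simp
    then have *: "t \<le> poly (pcompose b b') (nodes (ea x))"
      using t(1) poly_nat_mono2 by (simp add: poly_pcompose)
    have "eval (P @ [e]) (ea x) (Call (length P) e') (ec (f (g x))) (t' + t + nodes (ec (f (g x))))"
      by (rule eval.Call) (use t eval_append in auto)
    with * t nodes_le_time[OF t(2)]
    show "\<exists>t\<le>poly (b' + pcompose b b' + pcompose b b') (nodes (ea x)).
        eval (P @ [e]) (ea x) (Call (length P) e') (ec (f (g x))) t"
      by (intro exI conjI) auto
  qed
qed

lemma polytime_comp2:
  "polytime (enc_prod eb ec) ed (\<lambda>p. f (fst p) (snd p)) \<Longrightarrow> polytime ea eb g \<Longrightarrow> polytime ea ec h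
    \<Longrightarrow> polytime ea ed (\<lambda>x. f (g x) (h x))"
  using polytime_comp[of "enc_prod eb ec" ed "\<lambda>p. f (fst p) (snd p)" ea "\<lambda>x. (g x, h x)"]
  by (simp add: polytime_Pair)

lemma polytime_comp3:
  "polytime (enc_prod eb (enc_prod ec ed)) ee (\<lambda>p. f (fst p) (fst (snd p)) (snd (snd p)))
    \<Longrightarrow> polytime ea eb g \<Longrightarrow> polytime ea ec h \<Longrightarrow> polytime ea ed k
    \<Longrightarrow> polytime ea ee (\<lambda>x. f (g x) (h x) (k x))"
  using polytime_comp[of "enc_prod eb (enc_prod ec ed)" ee
      "\<lambda>p. f (fst p) (fst (snd p)) (snd (snd p))" ea "\<lambda>x. (g x, h x, k x)"]
  by (simp add: polytime_Pair)

text \<open>The recursion scheme behind all list functions. Polynomial time per step is not enough,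
  since the accumulator could grow by a constant factor at each step; hence \<open>bound\<close>.
  The accumulators met by \<open>foldr\<close> are the folds over suffixes of the list.\<close>

lemma polytime_foldr:
  assumes g: "polytime (enc_prod ea (enc_prod eb es)) es (\<lambda>p. g (fst p) (fst (snd p)) (snd (snd p)))"
    and l: "polytime ea (enc_list eb) l" and i: "polytime ea es i"
    and bound: "\<And>x ys. suffix ys (l x) \<Longrightarrow> nodes (es (foldr (g x) ys (i x))) \<le> poly b (nodes (ea x))"
  shows "polytime ea es (\<lambda>x. foldr (g x) (l x) (i x))"
proof -
  have li: "polytime ea (enc_prod (enc_list eb) es) (\<lambda>x. (l x, i x))"
    by (intro polytime_Pair l i)
  obtain P eg bg e' b' where
    1: "\<And>p. \<exists>t\<le>poly bg (nodes (enc_prod ea (enc_prod eb es) p)).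
          eval P (enc_prod ea (enc_prod eb es) p) eg (es (g (fst p) (fst (snd p)) (snd (snd p)))) t" and
    2: "\<And>x. \<exists>t\<le>poly b' (nodes (ea x)). eval P (ea x) e' (enc_prod (enc_list eb) es (l x, i x)) t"
    using polytime_same_program[OF g li] by metis
  define n where "n = length P"
  \<comment> \<open>Three functions follow the \<open>n\<close> old ones: \<open>n\<close> is the
    step, \<open>n + 1\<close> the start value, \<open>n + 2\<close> the recursion. The recursion
    receives the pair of \<open>x\<close> and the remaining list; an empty list is
    \<open>Leaf\<close>, which is false as a condition.\<close>
  define R where "R = If (Right Arg)
    (Call n (Cons (Left Arg) (Cons (Left (Right Arg)) (Call (n + 2) (Cons (Left Arg) (Right (Right Arg)))))))
    (Call (n + 1) (Left Arg))"
  define P' where "P' = P @ [eg, Right e', R]"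
  have P'_nth: "P' ! n = eg" "P' ! Suc n = Right e'" "P' ! Suc (Suc n) = R" "length P' = Suc (Suc (Suc n))"
    by (auto simp: P'_def n_def nth_append)
  have P'_R: "P' ! (n + 2) = R" by (simp add: P'_nth)
  have evG: "\<exists>t\<le>poly bg (nodes (ea x) + nodes (eb y) + nodes (es s) + 2).
      eval P' (Node (ea x) (Node (eb y) (es s))) eg (es (g x y s)) t" for x y s
  proof -
    obtain t where t: "t\<le>poly bg (nodes (enc_prod ea (enc_prod eb es) (x, y, s)))"
        "eval P (enc_prod ea (enc_prod eb es) (x, y, s)) eg (es (g x y s)) t"
      using 1[of "(x, y, s)"] by auto
    then show ?thesis using eval_append[OF t(2)] unfolding P'_def
      by (intro exI[of _ t]) (simp add: enc_prod_def add_ac)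
  qed
  have ev': "\<exists>t\<le>poly b' (nodes (ea x)). eval P' (ea x) e' (Node (enc_list eb (l x)) (es (i x))) t" for x
    using 2[of x] eval_append unfolding P'_def enc_prod_def fst_conv snd_conv by meson
  \<comment> \<open>\<open>A\<close> bounds the input together with the list, \<open>S\<close> every
    accumulator, and \<open>W\<close> the cost of one recursive call apart from the nested one. The
    factors 30 and 10 are generous counts of the trees copied on the way.\<close>
  define A S W where "A x = nodes (ea x) + nodes (enc_list eb (l x)) + 1"
    and "S x = poly b (nodes (ea x))"
    and "W x = 30 * A x + 10 * S x + 2 * poly b' (nodes (ea x))
        + poly bg (A x + S x + 2)" for x
  have evR: "\<exists>t\<le>(length ys + 1) * W x.
      eval P' (Node (ea x) (enc_list eb ys)) R (es (foldr (g x) ys (i x))) t"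
    if "suffix ys (l x)" for x ys
    using that
  proof (induction ys)
    case Nil
    obtain t where t: "t \<le> poly b' (nodes (ea x))"
        "eval P' (ea x) e' (Node (enc_list eb (l x)) (es (i x))) t"
      using ev' by blast
    have b0: "nodes (es (i x)) \<le> S x" using bound[of "[]" x] by (simp add: S_def)
    have "eval P' (Node (ea x) Leaf) (Right Arg) Leaf (nodes (Node (ea x) Leaf) + nodes Leaf)"
      using eval.Right[OF eval.Arg[of P' "Node (ea x) Leaf"]] by simp
    from eval.If_false[OF this eval.Call[OF eval.Left[OF eval.Arg], of "n + 1"]]
    have e0: "eval P' (Node (ea x) Leaf) R (es (i x))
       (nodes (Node (ea x) Leaf) + nodes Leaf + (nodes (Node (ea x) Leaf) + nodes (ea x) +
          (t + nodes (es (i x))) + nodes (es (i x))) + nodes (es (i x)))"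
      unfolding R_def using eval.Right[OF t(2)] P'_nth by simp
    show ?case unfolding enc_list_simps foldr.simps id_apply
      by (rule bounded_exI, rule e0) (use t b0 in \<open>auto simp: W_def A_def\<close>)
  next
    case (Cons y ys)
    then have suf: "suffix ys (l x)" by (meson suffix_ConsD)
    with Cons.IH obtain t where t: "t \<le> (length ys + 1) * W x"
      "eval P' (Node (ea x) (enc_list eb ys)) R (es (foldr (g x) ys (i x))) t" by blast
    let ?s = "foldr (g x) ys (i x)"
    obtain t' where t': "t' \<le> poly bg (nodes (ea x) + nodes (eb y) + nodes (es ?s) + 2)"
      "eval P' (Node (ea x) (Node (eb y) (es ?s))) eg (es (g x y ?s)) t'" using evG by blast
    have b1: "nodes (es ?s) \<le> S x" using bound[OF suf] by (simp add: S_def)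
    have b2: "nodes (es (g x y ?s)) \<le> S x" using bound[OF Cons.prems] by (simp add: S_def)
    have b3: "nodes (enc_list eb (y # ys)) \<le> nodes (enc_list eb (l x))"
      using Cons.prems by (auto simp: suffix_def nodes_enc_list)
    have b4: "t' \<le> poly bg (A x + S x + 2)"
      by (rule poly_nat_mono2[OF _ t'(1)]) (use b1 b3 in \<open>auto simp: A_def\<close>)
    let ?a = "Node (ea x) (Node (eb y) (enc_list eb ys))"
    have e1: "eval P' ?a (Right Arg) (Node (eb y) (enc_list eb ys)) (nodes ?a + nodes (Node (eb y) (enc_list eb ys)))"
      using eval.Right[OF eval.Arg[of P' ?a]] by simp
    have e2: "eval P' ?a (Left Arg) (ea x) (nodes ?a + nodes (ea x))"
      using eval.Left[OF eval.Arg[of P' ?a]] by simp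
    have e3: "eval P' ?a (Left (Right Arg)) (eb y)
        (nodes ?a + nodes (Node (eb y) (enc_list eb ys)) + nodes (eb y))"
      using eval.Left[OF e1] by simp
    have e4: "eval P' ?a (Right (Right Arg)) (enc_list eb ys)
        (nodes ?a + nodes (Node (eb y) (enc_list eb ys)) + nodes (enc_list eb ys))"
      using eval.Right[OF e1] by simp
    have n: "n < length P'" "n + 2 < length P'" by (simp_all add: P'_nth)
    note e5 = eval.Call[OF eval.Cons[OF e2 e4] n(2), unfolded P'_R, OF t(2)]
    note e6 = eval.Call[OF eval.Cons[OF e2 eval.Cons[OF e3 e5]] n(1), unfolded P'_nth, OF t'(2)]
    note e7 = eval.If_true[OF e1 _ e6]
    show ?case unfolding enc_list_simps foldr.simps comp_def R_def
      by (rule bounded_exI, rule e7)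
         (use P'_nth t b1 b2 b3 b4 in \<open>auto simp: W_def A_def\<close>)
  qed
  obtain bl where bl: "\<And>x. nodes (enc_list eb (l x)) \<le> poly bl (nodes (ea x))"
    using polytime_nodes[OF l] by blast
  define bA where "bA = [:1, 1:] + bl"
  have bA: "A x \<le> poly bA (nodes (ea x))" for x using bl[of x] by (simp add: bA_def A_def)
  define bW where "bW = 30 * bA + 10 * b + 2 * b' + pcompose bg (bA + b + 2)"
  have bW: "W x \<le> poly bW (nodes (ea x))" for x
    unfolding W_def bW_def S_def poly_add poly_mult poly_pcompose
    by (intro add_mono mult_mono poly_nat_mono bA) (use bA in auto)
  show ?thesis
  proof (rule polytimeI[where P = P' and e = "Call (n + 2) (Cons Arg (Left e'))"
        and b = "4 * bA + b' + b + (bl + 1) * bW"])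
    fix x
    obtain t where t: "t \<le> poly b' (nodes (ea x))"
        "eval P' (ea x) e' (Node (enc_list eb (l x)) (es (i x))) t"
      using ev' by blast
    obtain t' where t': "t' \<le> (length (l x) + 1) * W x"
      "eval P' (Node (ea x) (enc_list eb (l x))) R (es (foldr (g x) (l x) (i x))) t'"
      using evR[of "l x" x] by auto
    have b1: "nodes (es (foldr (g x) (l x) (i x))) \<le> poly b (nodes (ea x))"
      using bound[of "l x" x] by simp
    have "length (l x) \<le> nodes (enc_list eb (l x))" by (induction "l x" rule: list.induct) (auto simp: nodes_enc_list sum_list_Suc)
    then have "length (l x) \<le> poly bl (nodes (ea x))" using bl[of x] by simp
    then have "(length (l x) + 1) * W x \<le> poly ((bl + 1) * bW) (nodes (ea x))"
      unfolding poly_mult poly_add by (intro mult_mono add_mono bW) auto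
    then have b2: "t' \<le> poly ((bl + 1) * bW) (nodes (ea x))" using t'(1) by simp
    have e: "eval P' (ea x) (Call (n + 2) (Cons Arg (Left e'))) (es (foldr (g x) (l x) (i x)))
       (nodes (ea x) + (t + nodes (enc_list eb (l x))) + nodes (Node (ea x) (enc_list eb (l x))) + t'
         + nodes (es (foldr (g x) (l x) (i x))))"
      using eval.Call[OF eval.Cons[OF eval.Arg[of P' "ea x"] eval.Left[OF t(2)]], of "n + 2"] t'(2) P'_nth
      by simp
    show "\<exists>t\<le>poly (4 * bA + b' + b + (bl + 1) * bW) (nodes (ea x)).
      eval P' (ea x) (Call (n + 2) (Cons Arg (Left e'))) (es (foldr (g x) (l x) (i x))) t"
    proof (rule bounded_exI)
      show "nodes (ea x) + (t + nodes (enc_list eb (l x))) + nodes (Node (ea x) (enc_list eb (l x))) + t'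
         + nodes (es (foldr (g x) (l x) (i x))) \<le> poly (4 * bA + b' + b + (bl + 1) * bW) (nodes (ea x))"
        using b1 b2 t(1) bA[of x] unfolding A_def poly_add by simp
    qed (rule e)
  qed
qed

text \<open>If the growth in a step depends on \<open>x\<close> and \<open>y\<close> only, the
  increments add up along the list, and the size condition of the general rule holds
  automatically.\<close>

lemma polytime_foldr_additive:
  assumes g: "polytime (enc_prod ea (enc_prod eb es)) es (\<lambda>p. g (fst p) (fst (snd p)) (snd (snd p)))"
    and l: "polytime ea (enc_list eb) l" and i: "polytime ea es i"
    and add: "\<And>x y s. nodes (es (g x y s)) \<le> nodes (es s) + poly b (nodes (ea x) + nodes (eb y))"
  shows "polytime ea es (\<lambda>x. foldr (g x) (l x) (i x))"
proof -
  obtain bl where bl: "\<And>x. nodes (enc_list eb (l x)) \<le> poly bl (nodes (ea x))"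
    using polytime_nodes[OF l] by blast
  obtain bi where bi: "\<And>x. nodes (es (i x)) \<le> poly bi (nodes (ea x))"
    using polytime_nodes[OF i] by blast
  define bb where "bb = pcompose b ([:0, 1:] + bl)"
  show ?thesis
  proof (rule polytime_foldr[OF g l i, where b = "bl * bb + bi"])
    fix x ys assume "suffix ys (l x)"
    then have le: "nodes (enc_list eb ys) \<le> poly bl (nodes (ea x))"
      using bl[of x] by (auto simp: suffix_def nodes_enc_list)
    have "nodes (es (foldr (g x) ys (i x))) \<le> length ys * poly bb (nodes (ea x)) + nodes (es (i x))"
      using le
    proof (induction ys)
      case (Cons y ys)
      have "poly b (nodes (ea x) + nodes (eb y)) \<le> poly bb (nodes (ea x))"
        unfolding bb_def poly_pcompose using Cons.prems by (intro poly_nat_mono) simp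
      with Cons add[of x y "foldr (g x) ys (i x)"] show ?case by simp
    qed simp
    also have "length ys \<le> nodes (enc_list eb ys)" by (induction ys) auto
    then have "length ys * poly bb (nodes (ea x)) + nodes (es (i x)) \<le> poly (bl * bb + bi) (nodes (ea x))"
      using le bi[of x] by (auto intro!: add_mono mult_mono)
    finally show "nodes (es (foldr (g x) ys (i x))) \<le> poly (bl * bb + bi) (nodes (ea x))" .
  qed
qed

lemmas polytime_basic =
  polytime_id polytime_const polytime_fst polytime_snd polytime_Pair polytime_Cons polytime_if

lemma polytime_tl:
  assumes "polytime ea (enc_list eb) f"
  shows "polytime ea (enc_list eb) (\<lambda>x. tl (f x))"
proof (subst polytime_tree, rule polytime_cong[OF polytime_right[OF polytime_tree[THEN iffD1, OF assms]]])
  show "right (enc_list eb (f x)) = enc_list eb (tl (f x))" for x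
    by (cases "f x") auto
qed

lemma polytime_null:
  assumes "polytime ea (enc_list eb) f"
  shows "polytime ea tree_of_bool (\<lambda>x. f x = [])"
proof (rule polytime_cong[OF polytime_eq[OF polytime_tree[THEN iffD1, OF assms] polytime_const[where c = Leaf]]])
  show "tree_of_bool (enc_list eb (f x) = Leaf) = tree_of_bool (f x = [])" for x
    by (cases "f x") auto
qed auto

lemma polytime_not:
  assumes "polytime ea tree_of_bool c"
  shows "polytime ea tree_of_bool (\<lambda>x. \<not> c x)"
  by (rule polytime_cong[OF polytime_if[OF assms polytime_const[where c = False and eb = tree_of_bool] polytime_const[where c = True]]]) auto

lemma polytime_conj:
  assumes "polytime ea tree_of_bool c" "polytime ea tree_of_bool d"
  shows "polytime ea tree_of_bool (\<lambda>x. c x \<and> d x)"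
  by (rule polytime_cong[OF polytime_if[OF assms polytime_const[where c = False]]]) auto

lemma polytime_disj:
  assumes "polytime ea tree_of_bool c" "polytime ea tree_of_bool d"
  shows "polytime ea tree_of_bool (\<lambda>x. c x \<or> d x)"
  by (rule polytime_cong[OF polytime_if[OF assms(1) polytime_const[where c = True] assms(2)]]) auto

text \<open>Written as a fold so that the rule for folds covers it; unlike \<open>hd\<close> it has
  a chosen value on the empty list.\<close>

definition first :: "'a \<Rightarrow> 'a list \<Rightarrow> 'a" where
  "first d xs = foldr (\<lambda>x _. x) xs d"

lemma first_simps [simp]: "first d [] = d" "first d (x # xs) = x"
  by (auto simp: first_def)

lemma polytime_first:
  "polytime ea eb d \<Longrightarrow> polytime ea (enc_list eb) l \<Longrightarrow> polytime ea eb (\<lambda>x. first (d x) (l x))"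
  unfolding first_def
  by (rule polytime_foldr_additive[where b = "[:0, 1:]"]) ((rule polytime_basic | assumption)+, simp)

section \<open>Standard list functions as folds\<close>

lemma polytime_map:
  assumes "polytime (enc_prod ea eb) ec (\<lambda>p. h (fst p) (snd p))" "polytime ea (enc_list eb) l"
  shows "polytime ea (enc_list ec) (\<lambda>x. map (h x) (l x))"
proof -
  obtain b where b: "\<And>p. nodes (ec (h (fst p) (snd p))) \<le> poly b (nodes (enc_prod ea eb p))"
    using polytime_nodes[OF assms(1)] by blast
  have "map (h x) ys = foldr (\<lambda>y s. h x y # s) ys []" for x ys
    by (induction ys) auto
  moreover have "polytime ea (enc_list ec) (\<lambda>x. foldr (\<lambda>y s. h x y # s) (l x) [])"
  proof (rule polytime_foldr_additive[where b = "pcompose b [:1, 1:] + 1"])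
    show "nodes (enc_list ec (h x y # s)) \<le> nodes (enc_list ec s) + poly (pcompose b [:1, 1:] + 1) (nodes (ea x) + nodes (eb y))"
      for x y s
      using b[of "(x, y)"] by (simp add: enc_prod_def poly_pcompose)
  qed (rule polytime_comp2[OF assms(1)] polytime_basic assms)+
  ultimately show ?thesis by simp
qed

lemma polytime_filter:
  assumes "polytime (enc_prod ea eb) tree_of_bool (\<lambda>p. c (fst p) (snd p))" "polytime ea (enc_list eb) l"
  shows "polytime ea (enc_list eb) (\<lambda>x. filter (c x) (l x))"
proof -
  have "filter (c x) ys = foldr (\<lambda>y s. if c x y then y # s else s) ys []" for x ys
    by (induction ys) auto
  moreover have "polytime ea (enc_list eb) (\<lambda>x. foldr (\<lambda>y s. if c x y then y # s else s) (l x) [])"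
    by (rule polytime_foldr_additive[where b = "[:1, 1:]"])
       ((rule polytime_comp2[OF assms(1)] polytime_basic assms)+, simp)
  ultimately show ?thesis by simp
qed

lemma polytime_append:
  assumes "polytime ea (enc_list eb) f" "polytime ea (enc_list eb) g"
  shows "polytime ea (enc_list eb) (\<lambda>x. f x @ g x)"
proof -
  have "polytime ea (enc_list eb) (\<lambda>x. foldr (#) (f x) (g x))"
    by (rule polytime_foldr_additive[where b = "[:1, 1:]"]) ((rule polytime_basic assms)+, simp)
  then show ?thesis by (simp add: foldr_conv_fold fold_Cons_rev)
qed

lemma nodes_enc_list_append:
  "nodes (enc_list e (xs @ ys)) = nodes (enc_list e xs) + nodes (enc_list e ys) - 1"
  unfolding nodes_enc_list by simp

lemma polytime_concat:
  assumes "polytime ea (enc_list (enc_list eb)) l"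
  shows "polytime ea (enc_list eb) (\<lambda>x. concat (l x))"
  unfolding concat_conv_foldr
  by (rule polytime_foldr_additive[where b = "[:0, 1:]"])
     ((rule polytime_append polytime_basic assms)+, simp add: nodes_enc_list_append)

lemma polytime_rev:
  assumes "polytime ea (enc_list eb) l"
  shows "polytime ea (enc_list eb) (\<lambda>x. rev (l x))"
proof -
  have "rev xs = foldr (\<lambda>y s. s @ [y]) xs []" for xs :: "'b list"
    by (induction xs) auto
  moreover have "polytime ea (enc_list eb) (\<lambda>x. foldr (\<lambda>y s. s @ [y]) (l x) [])"
    by (rule polytime_foldr_additive[where b = "[:1, 1:]"])
       ((rule polytime_append polytime_basic assms)+, simp add: nodes_enc_list_append)
  ultimately show ?thesis by simp
qed

lemma polytime_member:
  assumes "polytime ea eb f" "polytime ea (enc_list eb) l" "inj eb"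
  shows "polytime ea tree_of_bool (\<lambda>x. f x \<in> set (l x))"
proof -
  have f: "polytime (enc_prod ea ed) eb (\<lambda>p. f (fst p))" for ed :: "'d \<Rightarrow> tree"
    by (rule polytime_comp[OF assms(1) polytime_fst[OF polytime_id]])
  have "polytime ea tree_of_bool (\<lambda>x. foldr (\<lambda>z s. f x = z \<or> s) (l x) False)"
  proof (rule polytime_foldr_additive[where b = "[:3:]"])
    show "polytime (enc_prod ea (enc_prod eb tree_of_bool)) tree_of_bool
        (\<lambda>p. f (fst p) = fst (snd p) \<or> snd (snd p))"
      by (rule polytime_disj polytime_eq[OF f] polytime_basic assms)+
  qed (use assms in \<open>auto intro: polytime_const simp: trans_le_add2\<close>)
  moreover have "foldr (\<lambda>z s. y = z \<or> s) ys False \<longleftrightarrow> y \<in> set ys" for y :: 'b and ys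
    by (induction ys) auto
  ultimately show ?thesis by simp
qed

lemma polytime_ball:
  assumes "polytime (enc_prod ea eb) tree_of_bool (\<lambda>p. c (fst p) (snd p))" "polytime ea (enc_list eb) l"
  shows "polytime ea tree_of_bool (\<lambda>x. \<forall>y\<in>set (l x). c x y)"
proof -
  have "polytime ea tree_of_bool (\<lambda>x. filter (\<lambda>y. \<not> c x y) (l x) = [])"
    by (rule polytime_null polytime_filter polytime_not assms)+
  then show ?thesis by (simp add: filter_empty_conv)
qed

lemma polytime_remdups:
  assumes "polytime ea (enc_list eb) l" "inj eb"
  shows "polytime ea (enc_list eb) (\<lambda>x. remdups (l x))"
proof -
  have "remdups ys = foldr (\<lambda>y s. if y \<in> set s then s else y # s) ys []" for ys :: "'b list"
    by (induction ys) (auto, metis set_remdups, metis set_remdups)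
  moreover have "polytime ea (enc_list eb) (\<lambda>x. foldr (\<lambda>y s. if y \<in> set s then s else y # s) (l x) [])"
    by (rule polytime_foldr_additive[where b = "[:1, 1:]"])
       ((rule polytime_member polytime_basic assms)+, simp)
  ultimately show ?thesis by simp
qed

text \<open>Each step copies the current suffix, so the growth depends on the accumulator and the
  additive rule does not apply; the total is quadratic. The suffix itself is carried in the first
  component.\<close>

lemma polytime_suffixes:
  assumes "polytime ea (enc_list eb) l"
  shows "polytime ea (enc_list (enc_list eb)) (\<lambda>x. suffixes (l x))"
proof -
  let ?g = "\<lambda>y s. (y # fst s, snd s @ [y # fst s])"
  have eq: "foldr ?g ys ([], [[]]) = (ys, suffixes ys)" for ys :: "'b list"
    by (induction ys) auto
  obtain b where b: "\<And>x. nodes (enc_list eb (l x)) \<le> poly b (nodes (ea x))"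
    using polytime_nodes[OF assms] by blast
  have "polytime ea (enc_prod (enc_list eb) (enc_list (enc_list eb))) (\<lambda>x. foldr ?g (l x) ([], [[]]))"
  proof (rule polytime_foldr[where b = "(b + 1) * (b + 2) + b + 2"])
    fix x ys assume "suffix ys (l x)"
    then have le: "nodes (enc_list eb ys) \<le> poly b (nodes (ea x))"
      using b[of x] by (auto simp: suffix_def nodes_enc_list)
    have "nodes (enc_list (enc_list eb) (suffixes ys)) \<le> 1 + (length ys + 1) * (1 + nodes (enc_list eb ys))"
      by (induction ys) (auto simp: nodes_enc_list_append algebra_simps)
    moreover have "length ys \<le> nodes (enc_list eb ys)" by (induction ys) auto
    ultimately have "nodes (enc_list (enc_list eb) (suffixes ys))
        \<le> 1 + (nodes (enc_list eb ys) + 1) * (1 + nodes (enc_list eb ys))"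
      by (meson add_le_mono le_trans mult_le_mono1 order_refl)
    also have "\<dots> \<le> 1 + (poly b (nodes (ea x)) + 1) * (1 + poly b (nodes (ea x)))"
      using le by (intro add_mono mult_mono) auto
    finally show "nodes (enc_prod (enc_list eb) (enc_list (enc_list eb)) (foldr ?g ys ([], [[]])))
        \<le> poly ((b + 1) * (b + 2) + b + 2) (nodes (ea x))"
      using le by (simp add: eq enc_prod_def)
  qed (rule polytime_append polytime_basic assms)+
  from polytime_snd[OF this] show ?thesis by (simp add: eq)
qed

text \<open>A fold runs along one list, so the other one travels in the accumulator and loses its
  head at every step. That head moves into the output, so the net growth depends only on the element
  of the first list. The default \<open>undefined\<close> is selected for no list, as
  \<open>first\<close> is taken of nonempty ones.\<close>

lemma polytime_zip:
  assumes "polytime ea (enc_list eb) f" "polytime ea (enc_list ec) g"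
  shows "polytime ea (enc_list (enc_prod eb ec)) (\<lambda>x. zip (f x) (g x))"
proof -
  let ?g = "\<lambda>d y s. if fst s = [] then s else (tl (fst s), (y, first d (fst s)) # snd s)"
  have eq: "rev (snd (foldr (?g d) (rev xs) (ys, acc))) = rev acc @ zip xs ys"
    for d and xs :: "'b list" and ys acc
  proof (induction xs arbitrary: ys acc)
    case (Cons x xs)
    show ?case by (cases ys) (use Cons in auto)
  qed auto
  have "polytime ea (enc_prod (enc_list ec) (enc_list (enc_prod eb ec)))
      (\<lambda>x. foldr (?g undefined) (rev (f x)) (g x, []))"
  proof (rule polytime_foldr_additive[where b = "[:2, 1:]"])
    fix x y and s :: "'c list \<times> ('b \<times> 'c) list"
    show "nodes (enc_prod (enc_list ec) (enc_list (enc_prod eb ec)) (?g undefined y s))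
      \<le> nodes (enc_prod (enc_list ec) (enc_list (enc_prod eb ec)) s) + poly [:2, 1:] (nodes (ea x) + nodes (eb y))"
      by (cases "fst s") (auto simp: enc_prod_def)
  qed (rule polytime_rev polytime_tl polytime_null polytime_first polytime_basic assms)+
  from polytime_rev[OF polytime_snd[OF this]] show ?thesis by (simp add: eq)
qed

lemma polytime_finite:
  fixes f :: "'a::finite \<Rightarrow> 'b"
  assumes "inj ea"
  shows "polytime ea eb f"
proof -
  obtain xs :: "'a list" where xs: "set xs = UNIV" using finite_list finite_UNIV by blast
  have "polytime ea eb (\<lambda>x. if x \<in> set xs then f x else undefined)" for xs
  proof (induction xs)
    case (Cons a xs)
    have "polytime ea eb (\<lambda>x. if x = a then f a else if x \<in> set xs then f x else undefined)"
      by (rule polytime_basic polytime_eq Cons.IH assms)+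
    then show ?case by (rule polytime_cong) auto
  qed (simp add: polytime_const)
  from this[of xs] show ?thesis by (simp add: xs)
qed

section \<open>Injectivity of the encodings\<close>

lemma inj_enc_prod: "inj ea \<Longrightarrow> inj eb \<Longrightarrow> inj (enc_prod ea eb)"
  by (auto simp: inj_def enc_prod_def)

lemma inj_enc_list:
  assumes "inj e" shows "inj (enc_list e)"
proof (rule injI)
  show "enc_list e xs = enc_list e ys \<Longrightarrow> xs = ys" for xs ys
  proof (induction xs arbitrary: ys)
    case Nil
    then show ?case by (cases ys) auto
  next
    case (Cons x xs)
    then show ?case by (cases ys) (auto dest: injD[OF assms])
  qed
qed

lemma inj_enc_nat: "inj enc_nat"
proof (rule injI)
  show "enc_nat m = enc_nat n \<Longrightarrow> m = n" for m n
  proof (induction m arbitrary: n rule: less_induct)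
    case (less m)
    show ?case
    proof (cases "m = 0 \<or> n = 0")
      case True
      with less.prems show ?thesis by (auto simp: enc_nat.simps split: if_splits)
    next
      case False
      with less.prems have "odd m = odd n" "enc_nat (m div 2) = enc_nat (n div 2)"
        by (auto simp: enc_nat.simps[of m] enc_nat.simps[of n] tree_of_bool_def split: if_splits)
      with less.IH[of "m div 2" "n div 2"] False have "odd m = odd n" "m div 2 = n div 2" by auto
      then show ?thesis by (metis odd_two_times_div_two_succ even_two_times_div_two)
    qed
  qed
qed

lemma inj_enc_pvar: "inj enc_pvar"
proof (rule injI)
  have "\<not> (enc_nat 0 = enc_nat 1 \<or> enc_nat 0 = enc_nat 2 \<or> enc_nat 1 = enc_nat 2)"
    by (auto dest: injD[OF inj_enc_nat])
  then show "enc_pvar x = enc_pvar y \<Longrightarrow> x = y" for x y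
    by (cases x; cases y) (auto dest: injD[OF inj_enc_nat])
qed

section \<open>Echelon bases\<close>

text \<open>For \<open>zip v b\<close> this is the entry of \<open>v\<close> divided by that of
  \<open>b\<close> at the first position where \<open>b\<close> is nonzero, that is, the multiple of
  \<open>b\<close> that clears \<open>v\<close> there; it is 0 if there is no such position.\<close>

definition ratio :: "('f::field \<times> 'f) list \<Rightarrow> 'f" where
  "ratio ps = foldr (\<lambda>p s. if snd p = 0 then s else fst p / snd p) ps 0"

definition reduce :: "'f::field list \<Rightarrow> 'f list \<Rightarrow> 'f list" where
  "reduce v b = map (\<lambda>p. fst p - ratio (zip v b) * snd p) (zip v b)"

text \<open>All stages of the reduction of \<open>v\<close>, the most reduced one in front and
  \<open>v\<close> itself at the end. In this order each stage arises from its predecessor by adding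
  a multiple of a row of \<open>bs\<close>, so the list can be written down as part of a
  derivation.\<close>

definition chain :: "'f::field list list \<Rightarrow> 'f list \<Rightarrow> 'f list list" where
  "chain bs v = foldr (\<lambda>b s. reduce (first [] s) b # s) bs [v]"

definition residue :: "'f::field list list \<Rightarrow> 'f list \<Rightarrow> 'f list" where
  "residue bs v = first [] (chain bs v)"

definition zero_row :: "'f::field list \<Rightarrow> bool" where
  "zero_row v \<longleftrightarrow> (\<forall>x\<in>set v. x = 0)"

definition basis :: "'f::field list list \<Rightarrow> 'f list list" where
  "basis vs = foldr (\<lambda>v bs. if zero_row (residue bs v) then bs else residue bs v # bs) vs []"

lemma chain_simps [simp]:
  "chain [] v = [v]"
  "chain (b # bs) v = reduce (residue bs v) b # chain bs v"
  by (auto simp: chain_def residue_def)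

lemma residue_simps [simp]:
  "residue [] v = v"
  "residue (b # bs) v = reduce (residue bs v) b"
  by (auto simp: residue_def)

lemma basis_simps [simp]:
  "basis [] = []"
  "basis (v # vs) = (if zero_row (residue (basis vs) v) then basis vs
     else residue (basis vs) v # basis vs)"
  by (auto simp: basis_def)

lemma length_reduce [simp]: "length (reduce v b) = min (length v) (length b)"
  by (simp add: reduce_def)

lemma nth_reduce:
  "length v = length b \<Longrightarrow> i < length v \<Longrightarrow> reduce v b ! i = v ! i - ratio (zip v b) * b ! i"
  by (simp add: reduce_def)

lemma residue_induct:
  assumes "Q v" "\<And>u b. Q u \<Longrightarrow> b \<in> set bs \<Longrightarrow> Q (reduce u b)"
  shows "Q (residue bs v)"
  using assms by (induction bs) auto

text \<open>Meant for properties preserved by elimination, such as the length of a row and vanishing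
  on the cube.\<close>

lemma basis_induct:
  assumes "\<And>v. v \<in> set vs \<Longrightarrow> Q v" "\<And>u b. Q u \<Longrightarrow> Q b \<Longrightarrow> Q (reduce u b)"
  shows "b \<in> set (basis vs) \<Longrightarrow> Q b"
  using assms(1)
proof (induction vs arbitrary: b)
  case (Cons v vs)
  have "Q (residue (basis vs) v)"
    by (rule residue_induct) (use Cons assms(2) in auto)
  with Cons show ?case by (auto split: if_splits)
qed auto

section \<open>Pivots and the dimension bound\<close>

definition pivot :: "'f::field list \<Rightarrow> nat" where
  "pivot v = length (takeWhile (\<lambda>x. x = 0) v)"

lemma pivot:
  assumes "\<not> zero_row v"
  shows "pivot v < length v" "v ! pivot v \<noteq> 0"
proof -
  from assms show "pivot v < length v"
    by (induction v) (auto simp: zero_row_def pivot_def)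
  then show "v ! pivot v \<noteq> 0"
    unfolding pivot_def by (rule nth_length_takeWhile)
qed

lemma ratio_pivot:
  "length v = length b \<Longrightarrow> \<not> zero_row b \<Longrightarrow> ratio (zip v b) = v ! pivot b / b ! pivot b"
  by (induction v b rule: list_induct2) (auto simp: ratio_def zero_row_def pivot_def)

lemma zero_row_reduce_self: "zero_row (reduce v v)"
proof (cases "zero_row v")
  case True
  then show ?thesis by (auto simp: zero_row_def reduce_def in_set_zip)
next
  case False
  then have "ratio (zip v v) = 1" using pivot[OF False] by (simp add: ratio_pivot)
  then show ?thesis by (auto simp: zero_row_def reduce_def in_set_zip)
qed

lemma zero_row_reduce:
  assumes "zero_row v"
  shows "zero_row (reduce v b)"
proof -
  have "ratio (zip v b) = 0" using assms
  proof (induction v arbitrary: b)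
    case (Cons x v)
    then show ?case by (cases b) (auto simp: ratio_def zero_row_def)
  qed (simp add: ratio_def)
  with assms show ?thesis by (auto simp: zero_row_def reduce_def in_set_zip)
qed

text \<open>When \<open>v\<close> is treated, its residue either is zero already or joins the basis
  and is cancelled by itself. Rows added later leave a zero row zero. Hence the chain of every input
  row begins with a zero row.\<close>

lemma zero_row_residue_basis: "v \<in> set vs \<Longrightarrow> zero_row (residue (basis vs) v)"
  by (induction vs) (auto simp: zero_row_reduce_self zero_row_reduce)

text \<open>Newer rows come first in the list; each of them vanishes at the pivots of all older ones.\<close>

fun echelon :: "'f::field list list \<Rightarrow> bool" where
  "echelon [] \<longleftrightarrow> True"
| "echelon (b # bs) \<longleftrightarrow> \<not> zero_row b \<and> (\<forall>c\<in>set bs. b ! pivot c = 0) \<and> echelon bs"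

lemma echelon_nonzero: "echelon bs \<Longrightarrow> b \<in> set bs \<Longrightarrow> \<not> zero_row b"
  by (induction bs) auto

text \<open>The newest row clears its own pivot and vanishes at all older ones, so subtracting a
  multiple of it preserves the zeros obtained before.\<close>

lemma residue_pivot:
  assumes "echelon bs" "\<forall>b\<in>set bs. length b = m" "length v = m" "c \<in> set bs"
  shows "residue bs v ! pivot c = 0"
  using assms
proof (induction bs)
  case (Cons b bs)
  have len: "length (residue bs v) = m"
    by (rule residue_induct[where Q = "\<lambda>v. length v = m"]) (use Cons.prems in auto)
  have c: "pivot c < m" "c ! pivot c \<noteq> 0"
    using Cons.prems echelon_nonzero pivot[of c] by metis+
  show ?case
  proof (cases "c = b")
    case True
    with Cons.prems len c show ?thesis by (simp add: nth_reduce ratio_pivot)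
  next
    case False
    with Cons.prems len c Cons.IH show ?thesis by (auto simp: nth_reduce)
  qed
qed auto

lemma basis_length: "\<forall>v\<in>set vs. length v = m \<Longrightarrow> b \<in> set (basis vs) \<Longrightarrow> length b = m"
  by (rule basis_induct[where Q = "\<lambda>v. length v = m"]) auto

lemma echelon_basis:
  assumes "\<forall>v\<in>set vs. length v = m"
  shows "echelon (basis vs)"
  using assms
proof (induction vs)
  case (Cons v vs)
  then show ?case using residue_pivot[of "basis vs" m v] basis_length[of vs m] by auto
qed auto

text \<open>The pivots are distinct positions below \<open>m\<close>: a newer row is zero at each
  older pivot but not at its own.\<close>

lemma echelon_length_le:
  assumes "echelon bs" "\<forall>b\<in>set bs. length b = m"
  shows "length bs \<le> m"
proof -
  have "distinct (map pivot bs)" using assms(1)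
  proof (induction bs)
    case (Cons b bs)
    then have "pivot b \<notin> pivot ` set bs" using pivot(2)[of b] by (metis echelon.simps(2) imageE)
    with Cons show ?case by simp
  qed auto
  moreover have "set (map pivot bs) \<subseteq> {..<m}"
    using assms echelon_nonzero pivot(1) by fastforce
  ultimately show ?thesis
    by (metis card_lessThan card_mono distinct_card finite_lessThan length_map)
qed

text \<open>The bound is independent of the length of \<open>vs\<close>; this undoes the doubling of
  the rows by each split.\<close>

lemma length_basis_le: "\<forall>v\<in>set vs. length v = m \<Longrightarrow> length (basis vs) \<le> m"
  by (rule echelon_length_le[OF echelon_basis]) (auto dest: basis_length)

section \<open>Derivations in the polynomial calculus\<close>

definition pc_step :: "pvar set \<Rightarrow> 'f::field mpoly set \<Rightarrow> 'f mpoly set \<Rightarrow> 'f mpoly \<Rightarrow> bool" where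
  "pc_step V P S l \<longleftrightarrow> l \<in> P
     \<or> (\<exists>p\<in>S. \<exists>q\<in>S. \<exists>a b. l = const_poly a * p + const_poly b * q)
     \<or> (\<exists>p\<in>S. \<exists>v\<in>V. l = var_poly v * p)"

text \<open>Line numbers are replaced by the set of available lines, which only grows. Pieces of the
  refutation can then be verified separately and appended.\<close>

fun derivable :: "pvar set \<Rightarrow> 'f::field mpoly set \<Rightarrow> 'f mpoly set \<Rightarrow> 'f mpoly list \<Rightarrow> bool" where
  "derivable V P S [] \<longleftrightarrow> True"
| "derivable V P S (l # ls) \<longleftrightarrow> pc_step V P S l \<and> derivable V P (insert l S) ls"

lemma pc_step_mono: "pc_step V P S l \<Longrightarrow> S \<subseteq> S' \<Longrightarrow> pc_step V P S' l"
  unfolding pc_step_def by blast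

lemma derivable_mono: "derivable V P S ls \<Longrightarrow> S \<subseteq> S' \<Longrightarrow> derivable V P S' ls"
proof (induction ls arbitrary: S S')
  case (Cons l ls)
  from Cons.prems Cons.IH[of "insert l S" "insert l S'"] pc_step_mono show ?case by auto
qed auto

lemma derivable_append:
  "derivable V P S (ls @ ls') \<longleftrightarrow> derivable V P S ls \<and> derivable V P (S \<union> set ls) ls'"
  by (induction ls arbitrary: S) auto

lemma derivable_concat:
  "(\<And>ls. ls \<in> set lss \<Longrightarrow> derivable V P S ls) \<Longrightarrow> derivable V P S (concat lss)"
proof (induction lss)
  case (Cons ls lss)
  then show ?case using derivable_mono[of V P S] by (auto simp: derivable_append)
qed auto

text \<open>Fits sums and products built up one term at a time: \<open>suffixes\<close> lists
  shorter suffixes before longer ones, so the line for \<open>s\<close> is available when that for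
  \<open>x # s\<close> is due.\<close>

lemma derivable_map_suffixes:
  assumes "pc_step V P S (f [])"
    and "\<And>x s. x \<in> set xs \<Longrightarrow> pc_step V P (insert (f s) S) (f (x # s))"
  shows "derivable V P S (map f (suffixes xs))"
  using assms(2)
proof (induction xs)
  case (Cons x xs)
  have "f xs \<in> set (map f (suffixes xs))" by simp
  then have "insert (f xs) S \<subseteq> S \<union> set (map f (suffixes xs))" by blast
  with Cons.prems[of x xs] have "pc_step V P (S \<union> set (map f (suffixes xs))) (f (x # xs))"
    using pc_step_mono by fastforce
  with Cons show ?case by (auto simp: derivable_append simp del: set_map)
qed (use assms(1) in simp)

lemma derivable_imp_pc_derivation:
  assumes "derivable V P {} ls"
  shows "pc_derivation V P ls"
proof -
  \<comment> \<open>Generalised to a verified prefix whose lines are the available ones.\<close>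
  have "pc_derivation V P (pre @ ls)" if "pc_derivation V P pre" "derivable V P (set pre) ls" for pre
    using that
  proof (induction ls arbitrary: pre)
    case (Cons l ls)
    have "pc_derivation V P (pre @ [l])"
      unfolding pc_derivation_def
    proof (intro allI impI)
      fix k assume "k < length (pre @ [l])"
      then consider "k < length pre" | "k = length pre" by fastforce
      then show "(pre @ [l]) ! k \<in> P
        \<or> (\<exists>i<k. \<exists>j<k. \<exists>a b. (pre @ [l]) ! k = const_poly a * (pre @ [l]) ! i + const_poly b * (pre @ [l]) ! j)
        \<or> (\<exists>i<k. \<exists>v\<in>V. (pre @ [l]) ! k = var_poly v * (pre @ [l]) ! i)"
      proof cases
        case 1
        then have "(pre @ [l]) ! i = pre ! i" if "i \<le> k" for i using that by (simp add: nth_append)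
        with 1 Cons.prems(1) show ?thesis unfolding pc_derivation_def by (metis less_imp_le order_refl)
      next
        case 2
        have *: "(\<exists>p\<in>set pre. Q p) \<longleftrightarrow> (\<exists>i<k. Q ((pre @ [l]) ! i))" for Q
          unfolding 2 by (metis in_set_conv_nth nth_append)
        from Cons.prems(2) have "pc_step V P (set pre) l" by simp
        with 2 show ?thesis unfolding pc_step_def * by simp
      qed
    qed
    with Cons.IH[of "pre @ [l]"] Cons.prems show ?case by simp
  qed simp
  from this[of "[]"] assms show ?thesis by (simp add: pc_derivation_def)
qed

section \<open>Polynomials of written lines and rows\<close>

lemma const_poly_simps [simp]:
  "const_poly 0 = 0" "const_poly 1 = 1" "const_poly (- a) = - const_poly a"
  by (auto simp: const_poly_def single_uminus)

lemma const_poly_add: "const_poly (a + b) = const_poly a + const_poly b"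
  by (simp add: const_poly_def single_add)

lemma const_poly_diff: "const_poly (a - b) = const_poly a - const_poly b"
  by (simp add: const_poly_def single_diff)

lemma const_poly_mult: "const_poly (a * b) = const_poly a * const_poly b"
  by (simp add: const_poly_def mult_single)

definition mon :: "pvar list \<Rightarrow> 'f::field mpoly" where
  "mon vs = prod_list (map var_poly vs)"

lemma mon_simps [simp]: "mon [] = 1" "mon (v # vs) = var_poly v * mon vs"
  by (auto simp: mon_def)

lemma poly_of_simps [simp]:
  "poly_of [] = 0"
  "poly_of (t # ts) = const_poly (fst t) * mon (snd t) + poly_of ts"
  "poly_of (ts @ us) = poly_of ts + poly_of us"
  by (auto simp: poly_of_def mon_def split: prod.splits)

lemma pc_step_lin:
  "p \<in> S \<Longrightarrow> q \<in> S \<Longrightarrow> l = const_poly a * p + const_poly b * q \<Longrightarrow> pc_step V P S l"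
  unfolding pc_step_def by blast

lemma pc_step_var: "p \<in> S \<Longrightarrow> v \<in> V \<Longrightarrow> l = var_poly v * p \<Longrightarrow> pc_step V P S l"
  unfolding pc_step_def by blast

lemma pc_step_member: "l \<in> S \<Longrightarrow> pc_step V P S l"
  by (rule pc_step_lin[where a = 1 and b = 0]) auto

lemma pc_step_zero: "S \<noteq> {} \<Longrightarrow> pc_step V P S 0"
  using pc_step_lin[where a = 0 and b = 0 and l = 0] by fastforce

lemma poly_of_zip_reduce:
  assumes "length v = length b" "length v = length Q"
  shows "poly_of (zip (reduce v b) Q) = poly_of (zip v Q) - const_poly (ratio (zip v b)) * poly_of (zip b Q)"
proof -
  \<comment> \<open>The ratio depends on the whole rows and would change along the induction, so an
    arbitrary \<open>c\<close> stands in for it.\<close>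
  have "poly_of (zip (map (\<lambda>p. fst p - c * snd p) (zip v b)) Q)
     = poly_of (zip v Q) - const_poly c * poly_of (zip b Q)" for c
    using assms(1) trans[OF assms(1)[symmetric] assms(2)]
    by (induction v b Q rule: list_induct3)
       (auto simp: const_poly_diff const_poly_mult algebra_simps)
  then show ?thesis by (simp add: reduce_def)
qed

lemma poly_of_zip_zero: "zero_row v \<Longrightarrow> poly_of (zip v Q) = 0"
proof (induction v arbitrary: Q)
  case (Cons x v)
  then show ?case by (cases Q) (auto simp: zero_row_def)
qed auto

lemma length_residue:
  "\<forall>b\<in>set bs. length b = m \<Longrightarrow> length v = m \<Longrightarrow> length (residue bs v) = m"
  by (rule residue_induct[where Q = "\<lambda>v. length v = m"]) auto

text \<open>A reduction step read backwards is a linear inference: the row before it equals the row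
  after it plus the ratio times the basis row. Only the residue, at the head of the chain, has to
  come from elsewhere.\<close>

lemma derivable_chain:
  assumes "\<forall>b\<in>set bs. length b = length Q \<and> poly_of (zip b Q) \<in> S" "length v = length Q"
    and "pc_step V P S (poly_of (zip (residue bs v) Q))"
  shows "derivable V P S (map (\<lambda>w. poly_of (zip w Q)) (chain bs v))"
  using assms(1,3)
proof (induction bs arbitrary: S)
  case (Cons b bs)
  let ?u = "residue bs v" and ?l = "\<lambda>w. poly_of (zip w Q)"
  have len: "length ?u = length Q" by (rule length_residue) (use Cons.prems assms(2) in auto)
  have "pc_step V P (insert (?l (reduce ?u b)) S) (?l ?u)"
    by (rule pc_step_lin[where p = "?l (reduce ?u b)" and q = "?l b" and a = 1 and b = "ratio (zip ?u b)"])
       (use Cons.prems len in \<open>auto simp: poly_of_zip_reduce\<close>)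
  with Cons.IH[of "insert (?l (reduce ?u b)) S"] Cons.prems show ?case by auto
qed (use assms(2) in auto)

lemma chain_last: "v \<in> set (chain bs v)"
  by (induction bs) auto

section \<open>Splitting on a variable\<close>

text \<open>Together with \<open>bv\<close> this gives the pair belonging to an index, so that a
  literal of either sign can name the variable to be split on.\<close>

fun xv :: "pvar \<Rightarrow> pvar" where
  "xv (X i) = X i" | "xv (XBar i) = X i" | "xv (Y i) = X i"

fun bv :: "pvar \<Rightarrow> pvar" where
  "bv (X i) = XBar i" | "bv (XBar i) = XBar i" | "bv (Y i) = XBar i"

text \<open>Setting \<open>y\<close> to 0 and its dual to 1 kills the monomials that contain
  \<open>y\<close>; the dual is then deleted by \<open>strip\<close>. As \<open>strip\<close>
  deletes both variables, the two restrictions are rows over one list of monomials and can enter the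
  same span.\<close>

definition zero_out :: "pvar \<Rightarrow> pvar list list \<Rightarrow> 'f::field list \<Rightarrow> 'f list" where
  "zero_out y Q v = map (\<lambda>p. if y \<in> set (snd p) then 0 else fst p) (zip v Q)"

definition strip :: "pvar \<Rightarrow> pvar list \<Rightarrow> pvar list" where
  "strip z q = filter (\<lambda>y. y \<noteq> xv z \<and> y \<noteq> bv z) q"

definition restrictions :: "pvar \<Rightarrow> pvar list list \<Rightarrow> 'f::field list list \<Rightarrow> 'f list list" where
  "restrictions z Q vs = map (zero_out (xv z) Q) vs @ map (zero_out (bv z) Q) vs"

definition compl_axiom :: "pvar \<Rightarrow> pvar list \<Rightarrow> 'f::field written_poly" where
  "compl_axiom z s = [(1, xv z # s), (1, bv z # s), (- 1, s)]"

text \<open>A row differs from the recombination of its two restrictions only in the monomials that do not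
  mention the variable, where the recombination has $x_i + \bar x_i$ instead of $1$.\<close>

definition correction :: "pvar \<Rightarrow> 'f::field \<times> pvar list \<Rightarrow> 'f written_poly" where
  "correction z p =
     map (\<lambda>t. ((if strip z (snd p) = snd p then - fst p else 0) * fst t, snd t)) (compl_axiom z (strip z (snd p)))"

definition split_sum :: "pvar \<Rightarrow> pvar list list \<Rightarrow> 'f::field list \<Rightarrow> 'f written_poly list" where
  "split_sum z Q v =
     [zip (zero_out (xv z) Q v) (map (\<lambda>q. bv z # strip z q) Q),
      zip (zero_out (bv z) Q v) (map (\<lambda>q. xv z # strip z q) Q)]"

text \<open>The empty suffix adds the two products, and each longer suffix adds the correction for
  one more monomial. The last entry is the same polynomial as its predecessor, written as a row
  again.\<close>

definition recombine :: "pvar \<Rightarrow> pvar list list \<Rightarrow> 'f::field list \<Rightarrow> 'f written_poly list" where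
  "recombine z Q v = split_sum z Q v
     @ map (\<lambda>s. concat (map (correction z) s) @ concat (split_sum z Q v)) (suffixes (zip v Q))
     @ [zip v Q]"

definition next_rows :: "pvar \<Rightarrow> pvar list list \<times> 'f::field list list \<Rightarrow> pvar list list \<times> 'f list list" where
  "next_rows z c = (map (strip z) (fst c), basis (restrictions z (fst c) (snd c)))"

definition written_rows :: "pvar list list \<times> 'f::field list list \<Rightarrow> 'f written_poly list" where
  "written_rows c = map (\<lambda>v. zip v (fst c)) (snd c)"

text \<open>Runs upwards: the rows of \<open>c\<close> are derived from those of
  \<open>next_rows z c\<close>, although the latter are computed from the former.\<close>

definition block :: "pvar \<Rightarrow> pvar list list \<times> 'f::field list list \<Rightarrow> 'f written_poly list" where
  "block z c =
     concat (map (\<lambda>v. written_rows (fst (next_rows z c), chain (snd (next_rows z c)) v)) (restrictions z (fst c) (snd c)))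
   @ concat (map (\<lambda>q. map (compl_axiom z) (suffixes (strip z q))) (fst c))
   @ concat (map (recombine z (fst c)) (snd c))"

section \<open>Verification of one split\<close>

lemma length_zero_out [simp]: "length (zero_out y Q v) = min (length v) (length Q)"
  by (simp add: zero_out_def)

lemma poly_of_compl_axiom:
  "poly_of (compl_axiom z s) = (var_poly (xv z) + var_poly (bv z) - 1) * mon s"
  by (simp add: compl_axiom_def algebra_simps)

lemma poly_of_correction:
  "poly_of (correction z p) =
     const_poly (if strip z (snd p) = snd p then - fst p else 0) * poly_of (compl_axiom z (strip z (snd p)))"
  by (simp add: correction_def compl_axiom_def const_poly_mult algebra_simps)

lemma xv_neq_bv [simp]: "xv z \<noteq> bv z" "bv z \<noteq> xv z"
  by (cases z; simp)+

lemma mon_filter: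
  "distinct q \<Longrightarrow> x \<in> set q \<Longrightarrow> mon q = var_poly x * mon (filter (\<lambda>y. y \<noteq> x) q)"
proof (induction q)
  case (Cons y q)
  show ?case
  proof (cases "x = y")
    case True
    with Cons.prems have "filter (\<lambda>y. y \<noteq> x) q = q" by (auto intro!: filter_True)
    with True show ?thesis by simp
  qed (use Cons in \<open>auto simp: algebra_simps\<close>)
qed simp

definition consistent :: "pvar list \<Rightarrow> bool" where
  "consistent q \<longleftrightarrow> distinct q \<and> (\<forall>z\<in>set q. \<not> (xv z \<in> set q \<and> bv z \<in> set q))"

lemma xv_bv_idem [simp]: "xv (xv z) = xv z" "xv (bv z) = xv z" "bv (xv z) = bv z" "bv (bv z) = bv z"
  by (cases z; simp)+

text \<open>A consistent monomial contains at most one variable of the pair, and that only once, so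
  deleting it divides the monomial by exactly this variable.\<close>

lemma strip_cases:
  assumes "consistent q"
  shows "xv z \<notin> set q \<and> bv z \<notin> set q \<and> strip z q = q
    \<or> xv z \<in> set q \<and> bv z \<notin> set q \<and> strip z q \<noteq> q \<and> (mon q :: 'f::field mpoly) = var_poly (xv z) * mon (strip z q)
    \<or> xv z \<notin> set q \<and> bv z \<in> set q \<and> strip z q \<noteq> q \<and> (mon q :: 'f::field mpoly) = var_poly (bv z) * mon (strip z q)"
proof -
  have "xv z \<notin> set q \<or> bv z \<notin> set q"
    using assms unfolding consistent_def by (metis xv_bv_idem)
  moreover have "strip z q = q \<longleftrightarrow> xv z \<notin> set q \<and> bv z \<notin> set q"
    unfolding strip_def filter_id_conv by auto
  moreover have "strip z q = filter (\<lambda>y. y \<noteq> xv z) q" if "bv z \<notin> set q"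
    unfolding strip_def using that by (auto intro!: filter_cong)
  moreover have "strip z q = filter (\<lambda>y. y \<noteq> bv z) q" if "xv z \<notin> set q"
    unfolding strip_def using that by (auto intro!: filter_cong)
  ultimately show ?thesis using assms mon_filter unfolding consistent_def by metis
qed

lemma consistent_strip: "consistent q \<Longrightarrow> consistent (strip z q)"
  by (auto simp: consistent_def strip_def)

lemma poly_of_zip_var:
  "poly_of (zip v (map (\<lambda>q. y # f q) Q)) = var_poly y * poly_of (zip v (map f Q))"
proof (induction v arbitrary: Q)
  case (Cons c v)
  then show ?case by (cases Q) (auto simp: algebra_simps)
qed auto

text \<open>Monomial by monomial: if a variable of the pair occurs, exactly one of the two products
  survives and restores the monomial. If none occurs, both survive and give the monomial times the
  sum of the pair, and the correction subtracts the excess over 1.\<close>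

lemma poly_of_recombined:
  fixes v :: "'f::field list"
  assumes "length v = length Q" "\<forall>q\<in>set Q. consistent q"
  shows "poly_of (zip v Q) =
     poly_of (concat (map (correction z) (zip v Q))) + poly_of (concat (split_sum z Q v))"
  using assms
proof (induction v Q rule: list_induct2)
  case (Cons c v q Q)
  have zo: "zero_out y (q # Q) (c # v) = (if y \<in> set q then 0 else c) # zero_out y Q v" for y
    by (simp add: zero_out_def)
  have "const_poly c * mon q = poly_of (correction z (c, q))
     + const_poly (if xv z \<in> set q then 0 else c) * (var_poly (bv z) * mon (strip z q))
     + const_poly (if bv z \<in> set q then 0 else c) * (var_poly (xv z) * mon (strip z q))"
    using strip_cases[where ?'f = 'f, OF bspec[OF Cons.prems, OF list.set_intros(1)], of z]
    by (elim disjE conjE) (simp_all add: poly_of_correction poly_of_compl_axiom, simp_all add: algebra_simps)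
  with Cons show ?case by (auto simp: zo split_sum_def)
qed (auto simp: split_sum_def zero_out_def)

lemma derivable_compl_axiom:
  assumes "var_poly (xv z) + var_poly (bv z) - 1 \<in> P" "set s \<subseteq> V"
  shows "derivable V P S (map (\<lambda>s. poly_of (compl_axiom z s)) (suffixes s))"
proof (rule derivable_map_suffixes)
  show "pc_step V P S (poly_of (compl_axiom z []))"
    using assms(1) by (simp add: pc_step_def poly_of_compl_axiom)
  show "pc_step V P (insert (poly_of (compl_axiom z s')) S) (poly_of (compl_axiom z (x # s')))"
    if "x \<in> set s" for x s'
    by (rule pc_step_var[where p = "poly_of (compl_axiom z s')" and v = x])
       (use that assms in \<open>auto simp: poly_of_compl_axiom algebra_simps\<close>)
qed

lemma derivable_recombine:
  assumes "xv z \<in> V" "bv z \<in> V"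
    and "poly_of (zip (zero_out (xv z) Q v) (map (strip z) Q)) \<in> S"
        "poly_of (zip (zero_out (bv z) Q v) (map (strip z) Q)) \<in> S"
    and "\<forall>q\<in>set Q. consistent q \<and> poly_of (compl_axiom z (strip z q)) \<in> S"
    and "length v = length Q"
  shows "derivable V P S (map poly_of (recombine z Q v))"
proof -
  let ?A = "poly_of (zip (zero_out (xv z) Q v) (map (\<lambda>q. bv z # strip z q) Q))"
    and ?B = "poly_of (zip (zero_out (bv z) Q v) (map (\<lambda>q. xv z # strip z q) Q))"
  let ?f = "\<lambda>s. poly_of (concat (map (correction z) s) @ concat (split_sum z Q v))"
  let ?S = "insert ?B (insert ?A S)"
  have "pc_step V P S ?A"
    by (rule pc_step_var[where v = "bv z", OF assms(3)]) (use assms in \<open>auto simp: poly_of_zip_var\<close>)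
  moreover have "pc_step V P (insert ?A S) ?B"
    by (rule pc_step_var[where v = "xv z", OF insertI2[OF assms(4)]]) (use assms in \<open>auto simp: poly_of_zip_var\<close>)
  moreover have "derivable V P ?S (map ?f (suffixes (zip v Q)))"
  proof (rule derivable_map_suffixes)
    show "pc_step V P ?S (?f [])"
      by (rule pc_step_lin[where p = ?A and q = ?B and a = 1 and b = 1]) (auto simp: split_sum_def)
    fix p s assume "p \<in> set (zip v Q)"
    then have "snd p \<in> set Q" by (metis prod.collapse set_zip_rightD)
    then show "pc_step V P (insert (?f s) ?S) (?f (p # s))"
      by (intro pc_step_lin[where p = "?f s" and q = "poly_of (compl_axiom z (strip z (snd p)))"
            and a = 1 and b = "if strip z (snd p) = snd p then - fst p else 0"])
         (use assms(5) in \<open>auto simp: poly_of_correction\<close>)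
  qed
  moreover have "pc_step V P (?S \<union> set (map ?f (suffixes (zip v Q)))) (poly_of (zip v Q))"
  proof (rule pc_step_member)
    have "poly_of (zip v Q) = ?f (zip v Q)" using poly_of_recombined[of v Q z] assms by simp
    also have "\<dots> \<in> set (map ?f (suffixes (zip v Q)))" by simp
    finally show "poly_of (zip v Q) \<in> ?S \<union> set (map ?f (suffixes (zip v Q)))" by blast
  qed
  ultimately show ?thesis
    unfolding recombine_def by (auto simp: split_sum_def derivable_append comp_def simp del: set_map)
qed

lemma derivable_block:
  assumes "xv z \<in> V" "bv z \<in> V" "var_poly (xv z) + var_poly (bv z) - 1 \<in> P"
    and Q: "\<forall>q\<in>set (fst c). consistent q \<and> set q \<subseteq> V"
    and len: "\<forall>v\<in>set (snd c). length v = length (fst c)"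
    and S: "S \<noteq> {}" "poly_of ` set (written_rows (next_rows z c)) \<subseteq> S"
  shows "derivable V P S (map poly_of (block z c))"
    and "poly_of ` set (written_rows c) \<subseteq> poly_of ` set (block z c)"
proof -
  obtain Q vs where c: "c = (Q, vs)" by (cases c)
  let ?Q = "map (strip z) Q" and ?r = "restrictions z Q vs"
  let ?L1 = "concat (map (\<lambda>v. written_rows (?Q, chain (basis ?r) v)) ?r)"
    and ?L2 = "concat (map (\<lambda>q. map (compl_axiom z) (suffixes (strip z q))) Q)"
    and ?L3 = "concat (map (recombine z Q) vs)"
  have lenr: "\<forall>v\<in>set ?r. length v = length Q"
    using len by (auto simp: restrictions_def c)
  have b: "\<forall>b\<in>set (basis ?r). length b = length ?Q \<and> poly_of (zip b ?Q) \<in> S"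
    using S basis_length[OF lenr] by (auto simp: written_rows_def next_rows_def c)
  have "derivable V P S (map poly_of ?L1)"
    unfolding map_concat map_map
  proof (rule derivable_concat)
    fix ls assume "ls \<in> set (map (map poly_of \<circ> (\<lambda>v. written_rows (?Q, chain (basis ?r) v))) ?r)"
    then obtain v where v: "v \<in> set ?r" and ls: "ls = map (\<lambda>w. poly_of (zip w ?Q)) (chain (basis ?r) v)"
      by (auto simp: written_rows_def comp_def)
    show "derivable V P S ls"
      unfolding ls
      by (rule derivable_chain[OF b])
         (use v lenr S in \<open>auto simp: poly_of_zip_zero zero_row_residue_basis pc_step_zero\<close>)
  qed
  moreover have "set (strip z q) \<subseteq> V" if "q \<in> set Q" for q
    using that Q by (fastforce simp: strip_def c)
  then have "derivable V P S' (map poly_of ?L2)" for S'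
    unfolding map_concat map_map
    by (intro derivable_concat)
       (use assms(3) in \<open>auto simp: comp_def intro!: derivable_compl_axiom\<close>)
  moreover have "derivable V P (S \<union> set (map poly_of ?L1) \<union> set (map poly_of ?L2)) (map poly_of ?L3)"
    unfolding map_concat[of poly_of "map (recombine z Q) vs"] map_map
  proof (rule derivable_concat)
    fix ls assume "ls \<in> set (map (map poly_of \<circ> recombine z Q) vs)"
    then obtain v where v: "v \<in> set vs" and ls: "ls = map poly_of (recombine z Q v)" by auto
    have *: "poly_of (zip w ?Q) \<in> set (map poly_of ?L1)" if "w \<in> set ?r" for w
      using that chain_last[of w "basis ?r"] by (auto simp: written_rows_def)
    have "compl_axiom z (strip z q) \<in> set ?L2" if "q \<in> set Q" for q
      using that by (auto intro!: bexI[of _ q] imageI)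
    then have **: "poly_of (compl_axiom z (strip z q)) \<in> set (map poly_of ?L2)" if "q \<in> set Q" for q
      using that by (metis image_eqI set_map)
    have r: "zero_out (xv z) Q v \<in> set ?r" "zero_out (bv z) Q v \<in> set ?r"
      using v by (auto simp: restrictions_def)
    show "derivable V P (S \<union> set (map poly_of ?L1) \<union> set (map poly_of ?L2)) ls"
      unfolding ls
    proof (rule derivable_recombine)
      show "poly_of (zip (zero_out (xv z) Q v) ?Q) \<in> S \<union> set (map poly_of ?L1) \<union> set (map poly_of ?L2)"
        using *[OF r(1)] by blast
      show "poly_of (zip (zero_out (bv z) Q v) ?Q) \<in> S \<union> set (map poly_of ?L1) \<union> set (map poly_of ?L2)"
        using *[OF r(2)] by blast
      show "\<forall>q\<in>set Q. consistent q \<and> poly_of (compl_axiom z (strip z q)) \<in> S \<union> set (map poly_of ?L1) \<union> set (map poly_of ?L2)"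
        using ** Q unfolding c fst_conv by blast
    qed (use assms v len in \<open>auto simp: c\<close>)
  qed
  ultimately show "derivable V P S (map poly_of (block z c))"
    unfolding block_def c next_rows_def fst_conv snd_conv map_append derivable_append by blast
  have "zip v Q \<in> set (block z c)" if "v \<in> set vs" for v
    using that by (auto simp: block_def c recombine_def)
  then show "poly_of ` set (written_rows c) \<subseteq> poly_of ` set (block z c)"
    by (auto simp: written_rows_def c)
qed

section \<open>The refutation\<close>

text \<open>Configurations descend while lines ascend: a new block is put in front, since it derives
  the rows from which the older blocks start. As this is a right fold, the last variable of
  \<open>zs\<close> is split first.\<close>

definition levels ::
    "pvar list \<Rightarrow> pvar list list \<times> 'f::field list list \<Rightarrow> (pvar list list \<times> 'f list list) \<times> 'f written_poly list" where
  "levels zs c = foldr (\<lambda>z st. (next_rows z (fst st), block z (fst st) @ snd st)) zs (c, [])"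

lemma levels_simps [simp]:
  "levels [] c = (c, [])"
  "levels (z # zs) c = (next_rows z (fst (levels zs c)), block z (fst (levels zs c)) @ snd (levels zs c))"
  by (auto simp: levels_def)

text \<open>The input may repeat and reorder literals. Filtering one fixed list of variables gives
  clauses that are equal as sets the same list, so that \<open>remdups\<close> removes copies.
  Tautological clauses, which no assignment falsifies, are dropped.\<close>

definition normal_clauses :: "pvar list list \<Rightarrow> pvar list list" where
  "normal_clauses cs = remdups (filter (\<lambda>q. \<forall>z\<in>set q. \<not> (xv z \<in> set q \<and> bv z \<in> set q))
     (map (\<lambda>c. filter (\<lambda>z. z \<in> set c) (remdups (concat cs))) cs))"

definition weakening :: "pvar list list \<Rightarrow> pvar list \<Rightarrow> pvar list" where
  "weakening fs q = first [] (filter (\<lambda>d. \<forall>y\<in>set d. y \<in> set q) fs)"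

text \<open>The axiom is spelled with the variables of \<open>q\<close> and not as listed in the
  input, where a repeated literal would produce a square instead of the translated clause.\<close>

definition weakening_lines :: "pvar list list \<Rightarrow> pvar list \<Rightarrow> 'f::field written_poly list" where
  "weakening_lines fs q =
     map (\<lambda>s. [(1, s @ filter (\<lambda>y. y \<in> set (weakening fs q)) q)])
       (suffixes (filter (\<lambda>y. y \<notin> set (weakening fs q)) q))"

text \<open>The empty monomial is the extra coordinate that carries the constant term.\<close>

definition initial_rows :: "pvar list list \<Rightarrow> pvar list list \<times> 'f::field list list" where
  "initial_rows qs = (qs @ [[]], [map (\<lambda>_. 1) qs @ [- 1]])"

text \<open>The empty suffix gives the negated initial row; adding the monomials one by one leaves
  the constant. Terms are not collected, so 1 appears with its cancelling terms written out.\<close>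

definition final_lines :: "pvar list list \<Rightarrow> 'f::field written_poly list" where
  "final_lines qs = map (\<lambda>s. map (Pair 1) s @ map (Pair (- 1)) qs @ [(1, [])]) (suffixes qs)"

text \<open>The rows of the last level are written as lines, although they turn out to be zero
  polynomials, because the blocks start from them. An index that occurs in both signs is split on
  twice; the second split finds nothing left to strip.\<close>

definition refutation :: "pvar list list \<Rightarrow> pvar list list \<Rightarrow> 'f::field written_poly list" where
  "refutation fs hs =
     concat (map (weakening_lines fs) (normal_clauses hs))
     @ written_rows (fst (levels (remdups (concat hs)) (initial_rows (normal_clauses hs))))
     @ snd (levels (remdups (concat hs)) (initial_rows (normal_clauses hs)))
     @ final_lines (normal_clauses hs)"

section \<open>Values of rows at Boolean assignments\<close>

fun holds :: "(nat \<Rightarrow> bool) \<Rightarrow> pvar \<Rightarrow> bool" where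
  "holds \<alpha> (X i) \<longleftrightarrow> \<alpha> i" | "holds \<alpha> (XBar i) \<longleftrightarrow> \<not> \<alpha> i" | "holds \<alpha> (Y i) \<longleftrightarrow> False"

definition row_value :: "(nat \<Rightarrow> bool) \<Rightarrow> 'f::field list \<Rightarrow> pvar list list \<Rightarrow> 'f" where
  "row_value \<alpha> v Q = (\<Sum>p\<leftarrow>zip v Q. if \<forall>y\<in>set (snd p). holds \<alpha> y then fst p else 0)"

lemma row_value_simps [simp]:
  "row_value \<alpha> [] Q = 0"
  "row_value \<alpha> v [] = 0"
  "row_value \<alpha> (c # v) (q # Q) = (if \<forall>y\<in>set q. holds \<alpha> y then c else 0) + row_value \<alpha> v Q"
  by (auto simp: row_value_def)

lemma row_value_reduce:
  assumes "length v = length b" "length v = length Q"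
  shows "row_value \<alpha> (reduce v b) Q = row_value \<alpha> v Q - ratio (zip v b) * row_value \<alpha> b Q"
proof -
  have "row_value \<alpha> (map (\<lambda>p. fst p - c * snd p) (zip v b)) Q
     = row_value \<alpha> v Q - c * row_value \<alpha> b Q" for c
    using assms(1) trans[OF assms(1)[symmetric] assms(2)]
    by (induction v b Q rule: list_induct3) (auto simp: algebra_simps)
  then show ?thesis by (simp add: reduce_def)
qed

fun index :: "pvar \<Rightarrow> nat" where
  "index (X i) = i" | "index (XBar i) = i" | "index (Y i) = i"

lemma holds_upd:
  "holds (\<alpha>(index z := b)) (xv z) = b" "holds (\<alpha>(index z := b)) (bv z) = (\<not> b)"
  "y \<noteq> xv z \<Longrightarrow> y \<noteq> bv z \<Longrightarrow> holds (\<alpha>(index z := b)) y = holds \<alpha> y"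
  by (cases z; cases y; auto)+

text \<open>Restricting a row amounts to fixing the variable in the assignment, so the restrictions
  of a row that vanishes on the cube vanish there too.\<close>

lemma row_value_zero_out:
  assumes "length v = length Q"
  shows "row_value \<alpha> (zero_out (xv z) Q v) (map (strip z) Q) = row_value (\<alpha>(index z := False)) v Q"
    and "row_value \<alpha> (zero_out (bv z) Q v) (map (strip z) Q) = row_value (\<alpha>(index z := True)) v Q"
proof -
  have 1: "(\<forall>y\<in>set q. holds (\<alpha>(index z := False)) y) \<longleftrightarrow> xv z \<notin> set q \<and> (\<forall>y\<in>set (strip z q). holds \<alpha> y)" for q
    using holds_upd by (auto simp: strip_def) metis+
  have 2: "(\<forall>y\<in>set q. holds (\<alpha>(index z := True)) y) \<longleftrightarrow> bv z \<notin> set q \<and> (\<forall>y\<in>set (strip z q). holds \<alpha> y)" for q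
    using holds_upd by (auto simp: strip_def) metis+
  show "row_value \<alpha> (zero_out (xv z) Q v) (map (strip z) Q) = row_value (\<alpha>(index z := False)) v Q"
    using assms by (induction v Q rule: list_induct2) (simp_all add: zero_out_def 1 del: fun_upd_apply)
  show "row_value \<alpha> (zero_out (bv z) Q v) (map (strip z) Q) = row_value (\<alpha>(index z := True)) v Q"
    using assms by (induction v Q rule: list_induct2) (simp_all add: zero_out_def 2 del: fun_upd_apply)
qed

definition vanishing :: "pvar set \<Rightarrow> pvar list list \<times> 'f::field list list \<Rightarrow> bool" where
  "vanishing V c \<longleftrightarrow> (\<forall>q\<in>set (fst c). consistent q \<and> set q \<subseteq> V)
     \<and> (\<forall>v\<in>set (snd c). length v = length (fst c) \<and> (\<forall>\<alpha>. row_value \<alpha> v (fst c) = 0))"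

lemma vanishing_next_rows:
  assumes "vanishing V c"
  shows "vanishing V (next_rows z c)"
proof -
  let ?R = "\<lambda>v. length v = length (fst c) \<and> (\<forall>\<alpha>. row_value \<alpha> v (map (strip z) (fst c)) = 0)"
  have "?R b" if "b \<in> set (basis (restrictions z (fst c) (snd c)))" for b
  proof (rule basis_induct[OF _ _ that])
    show "?R v" if "v \<in> set (restrictions z (fst c) (snd c))" for v
      using that assms by (auto simp: restrictions_def vanishing_def row_value_zero_out)
    show "?R (reduce u b)" if "?R u" "?R b" for u b
      using that by (simp add: row_value_reduce)
  qed
  moreover have "set (strip z q) \<subseteq> set q" for q by (auto simp: strip_def)
  ultimately show ?thesis
    using assms unfolding vanishing_def next_rows_def by (auto simp: consistent_strip) blast
qed

text \<open>Two directions in one induction: vanishing descends with the levels, derivability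
  ascends from the last level to \<open>c\<close>. \<open>S\<close> varies because the lines of the
  newest block become premises of the blocks after it.\<close>

lemma levels_correct:
  assumes "vanishing V c" "\<forall>z\<in>set zs. xv z \<in> V \<and> bv z \<in> V \<and> var_poly (xv z) + var_poly (bv z) - 1 \<in> P"
  shows "vanishing V (fst (levels zs c))
    \<and> (S \<noteq> {} \<longrightarrow> poly_of ` set (written_rows (fst (levels zs c))) \<subseteq> S \<longrightarrow>
       derivable V P S (map poly_of (snd (levels zs c)))
       \<and> poly_of ` set (written_rows c) \<subseteq> S \<union> poly_of ` set (snd (levels zs c)))"
  using assms(2)
proof (induction zs arbitrary: S)
  case (Cons z zs)
  let ?c = "fst (levels zs c)"
  have van: "vanishing V ?c" using Cons by auto
  show ?case
  proof (intro conjI impI)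
    show "vanishing V (fst (levels (z # zs) c))" using vanishing_next_rows[OF van] by simp
    assume S: "S \<noteq> {}" "poly_of ` set (written_rows (fst (levels (z # zs) c))) \<subseteq> S"
    have b: "derivable V P S (map poly_of (block z ?c))"
        "poly_of ` set (written_rows ?c) \<subseteq> poly_of ` set (block z ?c)"
      by (rule derivable_block; use Cons.prems S van in \<open>auto simp: vanishing_def\<close>)+
    with Cons.IH[of "S \<union> poly_of ` set (block z ?c)"] Cons.prems S
    show "derivable V P S (map poly_of (snd (levels (z # zs) c)))"
        "poly_of ` set (written_rows c) \<subseteq> S \<union> poly_of ` set (snd (levels (z # zs) c))"
      by (auto simp: derivable_append)
  qed
qed (use assms(1) in auto)

lemma fst_levels:
  "fst (fst (levels zs c)) = map (filter (\<lambda>y. \<forall>z\<in>set zs. y \<noteq> xv z \<and> y \<noteq> bv z)) (fst c)"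
  by (induction zs) (auto simp: next_rows_def strip_def intro!: filter_cong)

text \<open>Turns vanishing at a single assignment into equality with 0 once no variables are
  left.\<close>

lemma poly_of_zip_Nil:
  "\<forall>q\<in>set Q. q = [] \<Longrightarrow> poly_of (zip v Q) = const_poly (row_value \<alpha> v Q)"
proof (induction v arbitrary: Q)
  case (Cons x v)
  then show ?case by (cases Q) (auto simp: const_poly_add)
qed auto

section \<open>Normal forms, weakening and the final sum\<close>

lemma holds_translate_literal [simp]:
  "holds \<alpha> (translate_literal l) \<longleftrightarrow> \<not> true_lit \<alpha> l"
  "true_lit \<alpha> (complement l) \<longleftrightarrow> \<not> true_lit \<alpha> l"
  by (cases l; simp)+

lemma inj_translate_literal: "inj translate_literal"
proof (rule injI)
  show "translate_literal l = translate_literal l' \<Longrightarrow> l = l'" for l l'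
    by (cases l; cases l') auto
qed

lemma set_normal_clauses:
  "q \<in> set (normal_clauses cs) \<longleftrightarrow>
     (\<exists>c\<in>set cs. q = filter (\<lambda>z. z \<in> set c) (remdups (concat cs)) \<and> consistent q)"
  by (auto simp: normal_clauses_def consistent_def)

lemma set_filter_remdups: "c \<in> set cs \<Longrightarrow> set (filter (\<lambda>z. z \<in> set c) (remdups (concat cs))) = set c"
  by auto

lemma mon_filter_partition: "mon (filter (\<lambda>y. \<not> R y) q) * mon (filter R q) = mon q"
  by (induction q) (auto simp: algebra_simps)

lemma mon_append [simp]: "mon (s @ t) = mon s * mon t"
  by (simp add: mon_def)

lemma mon_translate_clause:
  assumes "distinct q" "set q = translate_literal ` C"
  shows "(mon q :: 'f::field mpoly) = translate_clause C"
proof -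
  have "(mon q :: 'f mpoly) = (\<Prod>y\<in>set q. var_poly y)"
    using assms(1) by (simp add: mon_def prod.distinct_set_conv_list)
  then show ?thesis
    unfolding assms(2) translate_clause_def
    using prod.reindex[OF inj_on_subset[OF inj_translate_literal], of C "var_poly :: _ \<Rightarrow> 'f mpoly"] by simp
qed

lemma first_filter: "\<exists>x\<in>set xs. R x \<Longrightarrow> first d (filter R xs) \<in> set xs \<and> R (first d (filter R xs))"
  by (induction xs) auto

lemma weakening:
  assumes "\<exists>d\<in>set fs. set d \<subseteq> set q"
  shows "weakening fs q \<in> set fs" "set (weakening fs q) \<subseteq> set q"
proof -
  from assms have "\<exists>d\<in>set fs. \<forall>y\<in>set d. y \<in> set q" by blast
  from first_filter[OF this, of "[]"]
  show "weakening fs q \<in> set fs" "set (weakening fs q) \<subseteq> set q"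
    unfolding weakening_def by blast+
qed

lemma derivable_weakening_lines:
  assumes "mon (filter (\<lambda>y. y \<in> set (weakening fs q)) q) \<in> P" "set q \<subseteq> V"
  shows "derivable V P S (map poly_of (weakening_lines fs q))"
  unfolding weakening_lines_def map_map comp_def
proof (rule derivable_map_suffixes)
  show "pc_step V P (insert (poly_of [(1, s @ filter (\<lambda>y. y \<in> set (weakening fs q)) q)]) S)
     (poly_of [(1, (x # s) @ filter (\<lambda>y. y \<in> set (weakening fs q)) q)])"
    if "x \<in> set (filter (\<lambda>y. y \<notin> set (weakening fs q)) q)" for x s
    by (rule pc_step_var[OF insertI1, where v = x]) (use that assms(2) in \<open>auto simp: algebra_simps\<close>)
qed (use assms(1) in \<open>simp add: pc_step_def\<close>)

lemma mon_weakening_lines: "mon q \<in> poly_of ` set (weakening_lines fs q)"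
proof
  let ?s = "filter (\<lambda>y. y \<notin> set (weakening fs q)) q" and ?d = "filter (\<lambda>y. y \<in> set (weakening fs q)) q"
  show "mon q = poly_of [(1, ?s @ ?d)]" by (simp add: mon_filter_partition)
  show "[(1, ?s @ ?d)] \<in> set (weakening_lines fs q)" by (auto simp: weakening_lines_def)
qed

lemma poly_of_map_Pair: "poly_of (map (Pair c) qs) = const_poly c * (\<Sum>q\<leftarrow>qs. mon q)"
  by (induction qs) (auto simp: algebra_simps)

lemma poly_of_initial_row:
  "poly_of (zip (map (\<lambda>_. 1) qs @ [- 1]) (qs @ [[]])) = (\<Sum>q\<leftarrow>qs. mon q) - 1"
  by (induction qs) auto

lemma derivable_final_lines:
  assumes "\<forall>q\<in>set qs. mon q \<in> S" "poly_of ` set (written_rows (initial_rows qs)) \<subseteq> S"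
  shows "derivable V P S (map poly_of (final_lines qs))" "1 \<in> poly_of ` set (final_lines qs)"
proof -
  let ?f = "\<lambda>s. map (Pair 1) s @ map (Pair (- 1)) qs @ [(1, [])]"
  have ini: "(\<Sum>q\<leftarrow>qs. mon q) - 1 \<in> S"
    using assms(2) unfolding written_rows_def initial_rows_def
    by (simp add: poly_of_initial_row del: zip_append)
  show "derivable V P S (map poly_of (final_lines qs))"
    unfolding final_lines_def map_map comp_def
  proof (rule derivable_map_suffixes)
    show "pc_step V P S (poly_of (?f []))"
      by (rule pc_step_lin[OF ini ini, where a = "- 1" and b = 0]) (simp add: poly_of_map_Pair)
    show "pc_step V P (insert (poly_of (?f s)) S) (poly_of (?f (q # s)))" if "q \<in> set qs" for q s
      by (rule pc_step_lin[of "poly_of (?f s)" _ "mon q" _ 1 1]) (use that assms(1) in auto)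
  qed
  show "1 \<in> poly_of ` set (final_lines qs)"
  proof
    show "1 = poly_of (?f qs)" by (simp add: poly_of_map_Pair)
    show "?f qs \<in> set (final_lines qs)" by (auto simp: final_lines_def)
  qed
qed

lemma row_value_initial:
  assumes "distinct qs" "\<exists>!q. q \<in> set qs \<and> (\<forall>y\<in>set q. holds \<alpha> y)"
  shows "row_value \<alpha> (map (\<lambda>_. 1) qs @ [- 1]) (qs @ [[]]) = (0 :: 'f::field)"
proof -
  let ?g = "\<lambda>q. (if \<forall>y\<in>set q. holds \<alpha> y then 1 else 0) :: 'f"
  have "row_value \<alpha> (map (\<lambda>_. 1) qs @ [- 1]) (qs @ [[]]) = (\<Sum>q\<leftarrow>qs. ?g q) - 1"
    by (induction qs) auto
  also have "(\<Sum>q\<leftarrow>qs. ?g q) = (\<Sum>q\<in>set qs. ?g q)"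
    using assms(1) by (simp add: sum_list_distinct_conv_sum_set)
  also obtain q0 where "{q \<in> set qs. \<forall>y\<in>set q. holds \<alpha> y} = {q0}"
    using assms(2) by (auto simp: set_eq_iff)
  then have "(\<Sum>q\<in>set qs. ?g q) = 1"
    by (simp flip: sum.inter_filter)
  finally show ?thesis by simp
qed

text \<open>A falsified clause exists by unsatisfiability, and as it is falsified it is not
  tautological, so it survives normalisation. Two falsified clauses cannot contain complementary
  literals, hence by the hitting property they are equal as sets and have the same normal
  form.\<close>

lemma hitting_unique:
  fixes H
  defines "hs \<equiv> map (map translate_literal) H"
  assumes "hitting (cnf_of H)" "unsatisfiable (cnf_of H)"
  shows "\<exists>!q. q \<in> set (normal_clauses hs) \<and> (\<forall>y\<in>set q. holds \<alpha> y)"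
proof -
  let ?nf = "\<lambda>c. filter (\<lambda>z. z \<in> set c) (remdups (concat hs))"
  have nf: "(\<forall>y\<in>set (?nf c). holds \<alpha> y) \<longleftrightarrow> (\<forall>y\<in>set c. holds \<alpha> y)" if "c \<in> set hs" for c
    using set_filter_remdups[OF that] by simp
  have cons: "consistent (?nf c)" if "c \<in> set hs" "\<forall>y\<in>set c. holds \<alpha> y" for c
  proof -
    have "\<not> (holds \<alpha> (xv z) \<and> holds \<alpha> (bv z))" for z by (cases z) auto
    then show ?thesis
      using that set_filter_remdups[OF that(1)] unfolding consistent_def by (metis distinct_filter distinct_remdups)
  qed
  obtain C where C: "C \<in> set H" "\<forall>l\<in>set C. \<not> true_lit \<alpha> l"
    using assms(3) unfolding unsatisfiable_def satisfies_def cnf_of_def by auto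
  let ?c = "map translate_literal C"
  have c: "?c \<in> set hs" "\<forall>y\<in>set ?c. holds \<alpha> y" using C by (auto simp: hs_def)
  show ?thesis
  proof (rule ex1I[of _ "?nf ?c"])
    show "?nf ?c \<in> set (normal_clauses hs) \<and> (\<forall>y\<in>set (?nf ?c). holds \<alpha> y)"
      using c nf cons set_normal_clauses by blast
    fix q assume q: "q \<in> set (normal_clauses hs) \<and> (\<forall>y\<in>set q. holds \<alpha> y)"
    then obtain D where D: "D \<in> set H" "q = ?nf (map translate_literal D)"
      by (auto simp: set_normal_clauses hs_def)
    with q nf[of "map translate_literal D"] have D': "\<forall>l\<in>set D. \<not> true_lit \<alpha> l"
      by (auto simp: hs_def)
    have "set C = set D"
    proof (rule ccontr)
      assume "set C \<noteq> set D"
      then obtain l where "l \<in> set C" "complement l \<in> set D"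
        using assms(2) C D unfolding hitting_def cnf_of_def by (metis imageI set_map)
      with C D' show False using holds_translate_literal(2) by blast
    qed
    then show "q = ?nf ?c" using D by simp
  qed
qed

lemma refutation_correct:
  assumes F: "cnf_over n (cnf_of F)" and H: "hitting_refutation n (cnf_of F) (cnf_of H)"
  shows "is_ext_pc_refutation n (translate_cnf n (cnf_of F))
     ([], refutation (map (map translate_literal) F) (map (map translate_literal) H) :: 'f::field written_poly list)"
proof -
  let ?fs = "map (map translate_literal) F" and ?hs = "map (map translate_literal) H"
  let ?qs = "normal_clauses ?hs" and ?zs = "remdups (concat ?hs)"
  let ?c = "initial_rows ?qs :: pvar list list \<times> 'f list list"
  let ?V = "original_vars n" and ?P = "translate_cnf n (cnf_of F) :: 'f mpoly set"
  have hit: "hitting (cnf_of H)" "unsatisfiable (cnf_of H)" "cnf_over n (cnf_of H)"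
    and weak: "\<And>C. C \<in> set H \<Longrightarrow> \<exists>D\<in>set F. set D \<subseteq> set C"
    using H unfolding hitting_refutation_def cnf_of_def by auto
  note uniq = hitting_unique[OF hit(1,2)]
  have zs: "\<exists>i\<in>{1..n}. z = X i \<or> z = XBar i" if "z \<in> set ?zs" for z
  proof -
    from that obtain C l where "C \<in> set H" "l \<in> set C" "z = translate_literal l" by auto
    moreover then have "variable l \<in> {1..n}" using hit(3) unfolding cnf_over_def cnf_of_def by fastforce
    ultimately show ?thesis by (cases l) auto
  qed
  have zsV: "set ?zs \<subseteq> ?V" using zs unfolding original_vars_def by blast
  have qs: "consistent q \<and> set q \<subseteq> set ?zs" if "q \<in> set ?qs" for q
    using that by (auto simp: set_normal_clauses)
  have "distinct ?qs" by (simp add: normal_clauses_def)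
  then have van: "vanishing ?V ?c"
    using row_value_initial[OF _ uniq] qs zsV
    by (fastforce simp: vanishing_def initial_rows_def consistent_def)
  have ax: "\<forall>z\<in>set ?zs. xv z \<in> ?V \<and> bv z \<in> ?V \<and> var_poly (xv z) + var_poly (bv z) - 1 \<in> ?P"
    using zs unfolding original_vars_def translate_cnf_def by fastforce
  have wk: "mon (filter (\<lambda>y. y \<in> set (weakening ?fs q)) q) \<in> ?P" if "q \<in> set ?qs" for q
  proof -
    obtain c where c: "c \<in> set ?hs" "q = filter (\<lambda>z. z \<in> set c) (remdups (concat ?hs))"
      using \<open>q \<in> set ?qs\<close> unfolding set_normal_clauses by blast
    then have "distinct q" "set q = set c" using set_filter_remdups[OF c(1)] by simp_all
    with c(1) obtain C where C: "C \<in> set H" "set q = translate_literal ` set C" "distinct q"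
      by auto
    with weak obtain D where "D \<in> set F" "set D \<subseteq> set C" by blast
    with C have "\<exists>d\<in>set ?fs. set d \<subseteq> set q" by (auto intro!: bexI[of _ D])
    from weakening[OF this] obtain D' where D': "D' \<in> set F" "weakening ?fs q = map translate_literal D'"
        "translate_literal ` set D' \<subseteq> set q" by auto
    have "mon (filter (\<lambda>y. y \<in> set (weakening ?fs q)) q) = (translate_clause (set D') :: 'f mpoly)"
      by (rule mon_translate_clause) (use C D' in auto)
    with D'(1) show ?thesis unfolding translate_cnf_def cnf_of_def by auto
  qed
  let ?W = "concat (map (weakening_lines ?fs) ?qs) :: 'f written_poly list"
  let ?st = "levels ?zs ?c"
  let ?S = "poly_of ` set ?W"
  have W: "derivable ?V ?P {} (map poly_of ?W)"
    unfolding map_concat map_map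
  proof (rule derivable_concat)
    fix ls :: "'f mpoly list"
    assume "ls \<in> set (map (map poly_of \<circ> weakening_lines ?fs) ?qs)"
    then obtain q where "q \<in> set ?qs" "ls = map poly_of (weakening_lines ?fs q)" by auto
    with derivable_weakening_lines[OF wk] qs zsV show "derivable ?V ?P {} ls" by blast
  qed
  have mons: "mon q \<in> ?S" if "q \<in> set ?qs" for q
    using mon_weakening_lines[of q ?fs] that by auto
  \<comment> \<open>Any assignment falsifies some clause, so there is a clause and with it a line
    from which 0 can be derived.\<close>
  obtain q where "q \<in> set ?qs" using ex1_implies_ex[OF uniq[of undefined]] by (elim exE conjE)
  from mons[OF this] have S: "?S \<noteq> {}" by (metis empty_iff)
  have lev: "vanishing ?V (fst ?st)" using levels_correct[OF van ax] by blast
  have empty: "\<forall>q\<in>set (fst (fst ?st)). q = []"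
  proof
    fix q assume "q \<in> set (fst (fst ?st))"
    then obtain q' where q': "q' \<in> set (fst ?c)" "q = filter (\<lambda>y. \<forall>z\<in>set ?zs. y \<noteq> xv z \<and> y \<noteq> bv z) q'"
      by (auto simp: fst_levels simp del: set_remdups set_concat)
    \<comment> \<open>Each variable of a monomial is itself among the split variables and names its
      own pair, so it has been stripped.\<close>
    have "y = xv y \<or> y = bv y" if "y \<in> set ?zs" for y using zs[OF that] by auto
    moreover have "set q' \<subseteq> set ?zs" using q'(1) qs by (auto simp: initial_rows_def)
    ultimately show "q = []" unfolding q'(2) filter_empty_conv by blast
  qed
  have zero: "poly_of l = 0" if l: "l \<in> set (written_rows (fst ?st))" for l
  proof -
    obtain v where v: "v \<in> set (snd (fst ?st))" "l = zip v (fst (fst ?st))"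
      using l unfolding written_rows_def by (metis (no_types, lifting) imageE set_map)
    then have "row_value undefined v (fst (fst ?st)) = 0" using lev unfolding vanishing_def by blast
    with poly_of_zip_Nil[OF empty, of v undefined] show ?thesis unfolding v(2) by (simp only: const_poly_simps)
  qed
  have R: "derivable ?V ?P T ls" if "T \<noteq> {}" "\<forall>l\<in>set ls. l = 0" for T and ls :: "'f mpoly list"
    using that by (induction ls arbitrary: T) (auto simp: pc_step_zero)
  have r0: "derivable ?V ?P ?S (map poly_of (written_rows (fst ?st)))"
    by (rule R) (use S zero in auto)
  let ?S1 = "?S \<union> poly_of ` set (written_rows (fst ?st))"
  have r1: "derivable ?V ?P ?S1 (map poly_of (snd ?st))"
    and i1: "poly_of ` set (written_rows ?c) \<subseteq> ?S1 \<union> poly_of ` set (snd ?st)"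
    using levels_correct[OF van ax, of ?S1] S by blast+
  have r2: "derivable ?V ?P (?S1 \<union> poly_of ` set (snd ?st)) (map poly_of (final_lines ?qs))"
    and i2: "1 \<in> poly_of ` set (final_lines ?qs :: 'f written_poly list)"
    by (rule derivable_final_lines; use mons i1 in blast)+
  have "derivable ?V ?P {} (map poly_of (refutation ?fs ?hs :: 'f written_poly list))"
    unfolding refutation_def map_append derivable_append set_map Un_empty_left
    using W r0 r1 r2 by (simp add: Un_assoc)
  then have "pc_derivation ?V ?P (map poly_of (refutation ?fs ?hs))" by (rule derivable_imp_pc_derivation)
  moreover have "1 \<in> poly_of ` set (refutation ?fs ?hs :: 'f written_poly list)"
    using i2 unfolding refutation_def by auto
  ultimately show ?thesis
    unfolding is_ext_pc_refutation_def ext_pc_refutation_def pc_refutation_def by simp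
qed

section \<open>Running time\<close>

text \<open>Only the tag of the encoding is replaced; the index is copied as a tree.\<close>

lemma polytime_xv: "polytime ea enc_pvar f \<Longrightarrow> polytime ea enc_pvar (\<lambda>x. xv (f x))"
  and polytime_bv: "polytime ea enc_pvar f \<Longrightarrow> polytime ea enc_pvar (\<lambda>x. bv (f x))"
proof -
  assume f: "polytime ea enc_pvar f"
  have r: "polytime ea (\<lambda>x. x) (\<lambda>x. right (enc_pvar (f x)))"
    by (rule polytime_right[OF polytime_tree[THEN iffD1, OF f]])
  show "polytime ea enc_pvar (\<lambda>x. xv (f x))"
  proof (rule polytime_Node[OF polytime_const[where c = "enc_nat 0" and eb = "\<lambda>x. x"] r])
    show "enc_pvar (xv (f x)) = Node (enc_nat 0) (right (enc_pvar (f x)))" for x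
      by (cases "f x") auto
  qed
  show "polytime ea enc_pvar (\<lambda>x. bv (f x))"
  proof (rule polytime_Node[OF polytime_const[where c = "enc_nat 1" and eb = "\<lambda>x. x"] r])
    show "enc_pvar (bv (f x)) = Node (enc_nat 1) (right (enc_pvar (f x)))" for x
      by (cases "f x") auto
  qed
qed

lemma polytime_translate_literal: "polytime enc_literal enc_pvar translate_literal"
proof (rule polytime_Node)
  show "polytime enc_literal (\<lambda>x. x) (\<lambda>l. if left (enc_literal l) = Leaf then enc_nat 0 else enc_nat 1)"
    by (rule polytime_if polytime_eq polytime_left polytime_tree[THEN iffD1, OF polytime_id] polytime_const inj_on_id2)+
  show "polytime enc_literal (\<lambda>x. x) (\<lambda>l. right (enc_literal l))"
    by (rule polytime_right polytime_tree[THEN iffD1, OF polytime_id])+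
  show "enc_pvar (translate_literal l)
      = Node (if left (enc_literal l) = Leaf then enc_nat 0 else enc_nat 1) (right (enc_literal l))" for l
    by (cases l) (auto simp: tree_of_bool_def)
qed

text \<open>In the rotated rules the list precedes the function applied to it, so the encoding of
  the elements is fixed when the function is examined.\<close>

lemmas polytime_control =
  polytime_const polytime_id polytime_Pair polytime_Cons polytime_append polytime_concat
  polytime_map[rotated] polytime_filter[rotated] polytime_ball[rotated] polytime_remdups
  polytime_suffixes polytime_zip polytime_first polytime_if polytime_not polytime_conj
  polytime_member polytime_eq polytime_xv polytime_bv polytime_fst polytime_snd
  inj_enc_prod inj_enc_list inj_enc_pvar

abbreviation "enc_mon \<equiv> enc_list enc_pvar"
abbreviation "enc_mons \<equiv> enc_list enc_mon"

lemma polytime_strip: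
  "polytime ea enc_pvar z \<Longrightarrow> polytime ea enc_mon q \<Longrightarrow> polytime ea enc_mon (\<lambda>x. strip (z x) (q x))"
proof (rule polytime_comp2[where f = strip])
  show "polytime (enc_prod enc_pvar enc_mon) enc_mon (\<lambda>p. strip (fst p) (snd p))"
    unfolding strip_def
    by (rule polytime_control)+
qed

lemma polytime_normal_clauses:
  "polytime ea enc_mons cs \<Longrightarrow> polytime ea enc_mons (\<lambda>x. normal_clauses (cs x))"
proof (rule polytime_comp[where f = normal_clauses])
  show "polytime enc_mons enc_mons normal_clauses"
    unfolding normal_clauses_def
    by (rule polytime_control)+
qed

lemma polytime_weakening:
  "polytime ea enc_mons fs \<Longrightarrow> polytime ea enc_mon q \<Longrightarrow> polytime ea enc_mon (\<lambda>x. weakening (fs x) (q x))"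
proof (rule polytime_comp2[where f = weakening])
  show "polytime (enc_prod enc_mons enc_mon) enc_mon (\<lambda>p. weakening (fst p) (snd p))"
    unfolding weakening_def
    by (rule polytime_control)+
qed

section \<open>Rows and lines over a finite field\<close>

context
  fixes ef :: "'f::{field,finite} \<Rightarrow> tree"
  assumes inj_ef: "inj ef"
begin

lemma polytime_field_binary:
  fixes f :: "'f \<Rightarrow> 'f \<Rightarrow> 'f"
  shows "polytime ea ef g \<Longrightarrow> polytime ea ef h \<Longrightarrow> polytime ea ef (\<lambda>x. f (g x) (h x))"
  by (rule polytime_comp2[OF polytime_finite]) (auto intro: inj_enc_prod inj_ef)

lemma polytime_uminus: "polytime ea ef g \<Longrightarrow> polytime ea ef (\<lambda>x. - g x :: 'f)"
  by (rule polytime_comp[OF polytime_finite]) (auto intro: inj_ef)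

lemmas polytime_field =
  polytime_field_binary[of _ _ _ plus] polytime_field_binary[of _ _ _ minus]
  polytime_field_binary[of _ _ _ times] polytime_field_binary[of _ _ _ divide]
  polytime_uminus inj_ef

abbreviation "enc_row \<equiv> enc_list ef"
abbreviation "enc_rows \<equiv> enc_list enc_row"
abbreviation "enc_line \<equiv> enc_list (enc_prod ef enc_mon)"
abbreviation "enc_lines \<equiv> enc_list enc_line"
abbreviation "enc_config \<equiv> enc_prod enc_mons enc_rows"

text \<open>The accumulator is a field element, and \<open>K\<close> bounds the encodings of all of
  them.\<close>

lemma polytime_ratio:
  assumes "polytime ea (enc_list (enc_prod ef ef)) l"
  shows "polytime ea ef (\<lambda>x. ratio (l x))"
proof -
  define K where "K = Max (range (\<lambda>c. nodes (ef c)))"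
  have K: "nodes (ef c) \<le> K" for c unfolding K_def by (rule Max_ge) auto
  show ?thesis
    unfolding ratio_def
    by (rule polytime_foldr_additive[where b = "[:K:]"])
       ((rule polytime_control polytime_field assms)+, simp add: trans_le_add2 K)
qed

lemma polytime_reduce:
  "polytime ea enc_row v \<Longrightarrow> polytime ea enc_row b \<Longrightarrow> polytime ea enc_row (\<lambda>x. reduce (v x) (b x))"
proof (rule polytime_comp2[where f = reduce])
  show "polytime (enc_prod enc_row enc_row) enc_row (\<lambda>p. reduce (fst p) (snd p))"
    unfolding reduce_def
    by (rule polytime_ratio polytime_field polytime_control)+
qed

lemma length_le_nodes: "length xs \<le> nodes (enc_list e xs)"
  by (induction xs) auto

lemma nodes_enc_list_le:
  "(\<And>x. x \<in> set xs \<Longrightarrow> nodes (e x) \<le> k) \<Longrightarrow> nodes (enc_list e xs) \<le> 1 + length xs * (1 + k)"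
proof (induction xs)
  case (Cons x xs)
  have "nodes (e x) \<le> k" "nodes (enc_list e xs) \<le> 1 + length xs * (1 + k)"
    using Cons by simp_all
  then show ?case by simp
qed simp

lemma nodes_le_nodes_enc_list: "x \<in> set xs \<Longrightarrow> nodes (e x) \<le> nodes (enc_list e xs)"
  by (induction xs) auto

text \<open>Elimination cannot make entries longer than a fixed constant, since the field is finite.
  The size of a row is therefore controlled by its length alone.\<close>

lemma nodes_row_le:
  obtains K where "\<And>v. nodes (enc_row v) \<le> 1 + length v * K"
proof -
  obtain K where K: "\<And>c. nodes (ef c) \<le> K"
    using Max_ge[of "range (\<lambda>c. nodes (ef c))"] by (metis finite_imageI finite_UNIV rangeI)
  have "nodes (enc_row v) \<le> 1 + length v * (1 + K)" for v
    by (rule nodes_enc_list_le) (rule K)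
  then show thesis by (rule that)
qed

lemma polytime_chain:
  assumes "polytime ea enc_rows bs" "polytime ea enc_row v"
  shows "polytime ea enc_rows (\<lambda>x. chain (bs x) (v x))"
proof -
  obtain K where K: "\<And>v. nodes (enc_row v) \<le> 1 + length v * K" using nodes_row_le by blast
  show ?thesis
    unfolding chain_def
  proof (rule polytime_foldr_additive[where b = "[:2, K:]"])
    fix x b and s :: "'f list list"
    \<comment> \<open>Zipping makes the reduced row at most as long as \<open>b\<close>, so the
      growth is bounded without reference to the accumulator.\<close>
    have "nodes (enc_row (reduce (first [] s) b)) \<le> 1 + min (length (first [] s)) (length b) * K"
      using K[of "reduce (first [] s) b"] by simp
    also have "\<dots> \<le> 1 + nodes (enc_row b) * K"
      using length_le_nodes[of b ef] by (intro add_mono mult_mono) auto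
    finally show "nodes (enc_rows (reduce (first [] s) b # s))
        \<le> nodes (enc_rows s) + poly [:2, K:] (nodes (ea x) + nodes (enc_row b))"
      by (simp add: algebra_simps)
  qed (rule polytime_reduce polytime_control assms)+
qed

lemma polytime_residue:
  "polytime ea enc_rows a \<Longrightarrow> polytime ea enc_row b
    \<Longrightarrow> polytime ea enc_row (\<lambda>x. residue (a x) (b x))"
proof (rule polytime_comp2[where f = residue])
  show "polytime (enc_prod enc_rows enc_row) enc_row (\<lambda>p. residue (fst p) (snd p))"
    unfolding residue_def
    by (rule polytime_chain polytime_field polytime_control)+
qed

lemma polytime_zero_row:
  "polytime ea enc_row a
    \<Longrightarrow> polytime ea tree_of_bool (\<lambda>x. zero_row (a x))"
proof (rule polytime_comp[where f = zero_row])
  show "polytime enc_row tree_of_bool zero_row"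
    unfolding zero_row_def
    by (rule polytime_field polytime_control)+
qed

lemma polytime_basis:
  assumes "polytime ea enc_rows vs"
  shows "polytime ea enc_rows (\<lambda>x. basis (vs x))"
proof -
  obtain K where K: "\<And>v. nodes (enc_row v) \<le> 1 + length v * K" using nodes_row_le by blast
  show ?thesis
    unfolding basis_def
  proof (rule polytime_foldr_additive[where b = "[:2, K:]"])
    fix x v and bs :: "'f list list"
    \<comment> \<open>Residues are never longer than \<open>v\<close>, even for rows of mixed
      lengths, so the additive rule applies.\<close>
    have "length (residue bs v) \<le> length v"
      by (rule residue_induct[where Q = "\<lambda>u. length u \<le> length v"]) auto
    then have "length (residue bs v) \<le> nodes (enc_row v)" using length_le_nodes[of v ef] by simp
    then have "nodes (enc_row (residue bs v)) \<le> 1 + nodes (enc_row v) * K"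
      using K[of "residue bs v"] mult_le_mono1 by (meson add_le_mono le_trans order_refl)
    then show "nodes (enc_rows (if zero_row (residue bs v) then bs else residue bs v # bs))
        \<le> nodes (enc_rows bs) + poly [:2, K:] (nodes (ea x) + nodes (enc_row v))"
      by (simp add: algebra_simps)
  qed (rule polytime_residue polytime_zero_row polytime_control assms)+
qed

lemma polytime_zero_out:
  "polytime ea enc_pvar a \<Longrightarrow> polytime ea enc_mons b \<Longrightarrow> polytime ea enc_row c
    \<Longrightarrow> polytime ea enc_row (\<lambda>x. zero_out (a x) (b x) (c x))"
proof (rule polytime_comp3[where f = zero_out])
  show "polytime (enc_prod enc_pvar (enc_prod enc_mons enc_row)) enc_row (\<lambda>p. zero_out (fst p) (fst (snd p)) (snd (snd p)))"
    unfolding zero_out_def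
    by (rule polytime_field polytime_control)+
qed

lemma polytime_restrictions:
  "polytime ea enc_pvar a \<Longrightarrow> polytime ea enc_mons b \<Longrightarrow> polytime ea enc_rows c
    \<Longrightarrow> polytime ea enc_rows (\<lambda>x. restrictions (a x) (b x) (c x))"
proof (rule polytime_comp3[where f = restrictions])
  show "polytime (enc_prod enc_pvar (enc_prod enc_mons enc_rows)) enc_rows (\<lambda>p. restrictions (fst p) (fst (snd p)) (snd (snd p)))"
    unfolding restrictions_def
    by (rule polytime_zero_out polytime_field polytime_control)+
qed

lemma polytime_compl_axiom:
  "polytime ea enc_pvar a \<Longrightarrow> polytime ea enc_mon b
    \<Longrightarrow> polytime ea enc_line (\<lambda>x. compl_axiom (a x) (b x))"
proof (rule polytime_comp2[where f = compl_axiom])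
  show "polytime (enc_prod enc_pvar enc_mon) enc_line (\<lambda>p. compl_axiom (fst p) (snd p))"
    unfolding compl_axiom_def
    by (rule polytime_field polytime_control)+
qed

lemma polytime_correction:
  "polytime ea enc_pvar a \<Longrightarrow> polytime ea (enc_prod ef enc_mon) b
    \<Longrightarrow> polytime ea enc_line (\<lambda>x. correction (a x) (b x))"
proof (rule polytime_comp2[where f = correction])
  show "polytime (enc_prod enc_pvar (enc_prod ef enc_mon)) enc_line (\<lambda>p. correction (fst p) (snd p))"
    unfolding correction_def
    by (rule polytime_strip polytime_compl_axiom polytime_field polytime_control)+
qed

lemma polytime_split_sum:
  "polytime ea enc_pvar a \<Longrightarrow> polytime ea enc_mons b \<Longrightarrow> polytime ea enc_row c
    \<Longrightarrow> polytime ea enc_lines (\<lambda>x. split_sum (a x) (b x) (c x))"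
proof (rule polytime_comp3[where f = split_sum])
  show "polytime (enc_prod enc_pvar (enc_prod enc_mons enc_row)) enc_lines (\<lambda>p. split_sum (fst p) (fst (snd p)) (snd (snd p)))"
    unfolding split_sum_def
    by (rule polytime_strip polytime_zero_out polytime_field polytime_control)+
qed

lemma polytime_recombine:
  "polytime ea enc_pvar a \<Longrightarrow> polytime ea enc_mons b \<Longrightarrow> polytime ea enc_row c
    \<Longrightarrow> polytime ea enc_lines (\<lambda>x. recombine (a x) (b x) (c x))"
proof (rule polytime_comp3[where f = recombine])
  show "polytime (enc_prod enc_pvar (enc_prod enc_mons enc_row)) enc_lines (\<lambda>p. recombine (fst p) (fst (snd p)) (snd (snd p)))"
    unfolding recombine_def
    by (rule polytime_correction polytime_split_sum polytime_field polytime_control)+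
qed

lemma polytime_next_rows:
  "polytime ea enc_pvar a \<Longrightarrow> polytime ea enc_config b
    \<Longrightarrow> polytime ea enc_config (\<lambda>x. next_rows (a x) (b x))"
proof (rule polytime_comp2[where f = next_rows])
  show "polytime (enc_prod enc_pvar enc_config) enc_config (\<lambda>p. next_rows (fst p) (snd p))"
    unfolding next_rows_def
    by (rule polytime_strip polytime_basis polytime_restrictions polytime_field polytime_control)+
qed

lemma polytime_written_rows:
  "polytime ea enc_config a
    \<Longrightarrow> polytime ea enc_lines (\<lambda>x. written_rows (a x))"
proof (rule polytime_comp[where f = written_rows])
  show "polytime enc_config enc_lines written_rows"
    unfolding written_rows_def
    by (rule polytime_field polytime_control)+
qed

lemma polytime_block:
  "polytime ea enc_pvar a \<Longrightarrow> polytime ea enc_config b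
    \<Longrightarrow> polytime ea enc_lines (\<lambda>x. block (a x) (b x))"
proof (rule polytime_comp2[where f = block])
  show "polytime (enc_prod enc_pvar enc_config) enc_lines (\<lambda>p. block (fst p) (snd p))"
    unfolding block_def
    by (rule polytime_strip polytime_compl_axiom polytime_recombine polytime_next_rows polytime_written_rows polytime_chain polytime_restrictions polytime_field polytime_control)+
qed

lemma polytime_weakening_lines:
  "polytime ea enc_mons a \<Longrightarrow> polytime ea enc_mon b
    \<Longrightarrow> polytime ea enc_lines (\<lambda>x. weakening_lines (a x) (b x))"
proof (rule polytime_comp2[where f = weakening_lines])
  show "polytime (enc_prod enc_mons enc_mon) enc_lines (\<lambda>p. weakening_lines (fst p) (snd p))"
    unfolding weakening_lines_def
    by (rule polytime_weakening polytime_field polytime_control)+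
qed

lemma polytime_initial_rows:
  "polytime ea enc_mons a
    \<Longrightarrow> polytime ea enc_config (\<lambda>x. initial_rows (a x))"
proof (rule polytime_comp[where f = initial_rows])
  show "polytime enc_mons enc_config initial_rows"
    unfolding initial_rows_def
    by (rule polytime_field polytime_control)+
qed

lemma polytime_final_lines:
  "polytime ea enc_mons a
    \<Longrightarrow> polytime ea enc_lines (\<lambda>x. final_lines (a x))"
proof (rule polytime_comp[where f = final_lines])
  show "polytime enc_mons enc_lines final_lines"
    unfolding final_lines_def
    by (rule polytime_field polytime_control)+
qed

section \<open>Size bounds for the levels\<close>

lemma nodes_enc_list_mono:
  "list_all2 (\<lambda>x y. nodes (e x) \<le> nodes (e y)) xs ys \<Longrightarrow> nodes (enc_list e xs) \<le> nodes (enc_list e ys)"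
  by (induction rule: list_all2_induct) auto

lemma nodes_filter_le: "nodes (enc_list e (filter R xs)) \<le> nodes (enc_list e xs)"
  by (induction xs) auto

text \<open>The first alternative covers the start, before any elimination; after a split the
  dimension bound applies. In both cases the number of rows does not depend on how many variables
  have been split.\<close>

lemma levels_rows:
  assumes "\<forall>v\<in>set (snd c). length v = length (fst c)"
  shows "(\<forall>v\<in>set (snd (fst (levels zs c))). length v = length (fst c))
    \<and> (snd (fst (levels zs c)) = snd c \<or> length (snd (fst (levels zs c))) \<le> length (fst c))"
proof (induction zs)
  case (Cons z zs)
  let ?r = "restrictions z (fst (fst (levels zs c))) (snd (fst (levels zs c)))"
  have r: "\<forall>v\<in>set ?r. length v = length (fst c)"
    using Cons by (auto simp: restrictions_def fst_levels)
  show ?case using basis_length[OF r] length_basis_le[OF r] by (auto simp: next_rows_def)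
qed (use assms in auto)

lemma polytime_levels:
  assumes zs: "polytime ea enc_mon zs" and c: "polytime ea enc_config c"
    and len: "\<And>x. \<forall>v\<in>set (snd (c x)). length v = length (fst (c x))"
  shows "polytime ea (enc_prod enc_config enc_lines) (\<lambda>x. levels (zs x) (c x))"
proof -
  obtain K where K: "\<And>v. nodes (enc_row v) \<le> 1 + length v * K" using nodes_row_le by blast
  obtain bz where bz: "\<And>x. nodes (enc_mon (zs x)) \<le> poly bz (nodes (ea x))"
    using polytime_nodes[OF zs] by blast
  obtain bc where bc: "\<And>x. nodes (enc_config (c x)) \<le> poly bc (nodes (ea x))"
    using polytime_nodes[OF c] by blast
  obtain bb where bb: "\<And>z c. nodes (enc_lines (block z c)) \<le> poly bb (1 + nodes (enc_pvar z) + nodes (enc_config c))"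
  proof -
    have "polytime (enc_prod enc_pvar enc_config) enc_lines (\<lambda>p. block (fst p) (snd p))"
      by (rule polytime_block polytime_control)+
    from polytime_nodes[OF this] obtain b where
      "\<And>p. nodes (enc_lines (block (fst p) (snd p))) \<le> poly b (nodes (enc_prod enc_pvar enc_config p))" by blast
    from this[of "(_, _)"] show ?thesis by (intro that[of b]) (simp add: enc_prod_def)
  qed
  \<comment> \<open>The monomials take at most \<open>bc\<close>. The rows take \<open>bc\<close> at
    the start, and later they are at most \<open>bc\<close> rows of at most \<open>bc\<close>
    entries, with \<open>K\<close> bounding the space per entry.\<close>
  define bC where "bC = 2 + 2 * bc + bc * (2 + bc * [:K:])"
  define bB where "bB = pcompose bb (1 + bz + bC)"
  have config: "nodes (enc_config (fst (levels ys (c x)))) \<le> poly bC (nodes (ea x))" for x ys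
  proof -
    let ?n = "poly bc (nodes (ea x))" and ?q = "fst (fst (levels ys (c x)))" and ?r = "snd (fst (levels ys (c x)))"
    have n: "nodes (enc_mons (fst (c x))) + nodes (enc_rows (snd (c x))) \<le> ?n"
      using bc[of x] by (simp add: enc_prod_def)
    then have m: "length (fst (c x)) \<le> ?n" using length_le_nodes[of "fst (c x)" enc_mon] by simp
    have "nodes (enc_mons ?q) \<le> nodes (enc_mons (fst (c x)))"
      unfolding fst_levels by (rule nodes_enc_list_mono) (auto simp: list_all2_conv_all_nth nodes_filter_le)
    then have q: "nodes (enc_mons ?q) \<le> ?n" using n by simp
    have row: "nodes (enc_row v) \<le> 1 + ?n * K" if "v \<in> set ?r" for v
    proof -
      have "length v \<le> ?n" using levels_rows[OF len[of x], of ys] that m by auto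
      then show ?thesis using K[of v] mult_le_mono1 by (meson add_le_mono le_trans order_refl)
    qed
    have "nodes (enc_rows ?r) \<le> 1 + length ?r * (2 + ?n * K)"
      using nodes_enc_list_le[of ?r enc_row "1 + ?n * K"] row by simp
    moreover have "?r = snd (c x) \<or> length ?r \<le> ?n" using levels_rows[OF len[of x], of ys] m by auto
    ultimately have "nodes (enc_rows ?r) \<le> ?n + (1 + ?n * (2 + ?n * K))"
      using n mult_le_mono1[of "length ?r" ?n "2 + ?n * K"] by auto
    with q have "nodes (enc_config (fst (levels ys (c x)))) \<le> 2 + 2 * ?n + ?n * (2 + ?n * K)"
      by (simp add: enc_prod_def)
    then show ?thesis by (simp add: bC_def ac_simps)
  qed
  have lines: "nodes (enc_lines (snd (levels ys (c x)))) \<le> 1 + length ys * poly bB (nodes (ea x))"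
    if "set ys \<subseteq> set (zs x)" for x ys
    using that
  proof (induction ys)
    case (Cons z ys)
    have "nodes (enc_pvar z) \<le> nodes (enc_mon (zs x))"
      using Cons.prems by (intro nodes_le_nodes_enc_list) simp
    then have "nodes (enc_lines (block z (fst (levels ys (c x))))) \<le> poly bB (nodes (ea x))"
      unfolding bB_def poly_pcompose
      using bz[of x] config[of ys x] by (intro poly_nat_mono2[OF _ bb]) simp
    with Cons show ?case by (simp add: nodes_enc_list_append)
  qed simp
  show ?thesis
    unfolding levels_def
  proof (rule polytime_foldr[where b = "2 + bC + bz * bB"])
    fix x ys assume suf: "suffix ys (zs x)"
    then have sub: "set ys \<subseteq> set (zs x)" by (rule set_mono_suffix)
    have "length ys \<le> length (zs x)" using suf by (rule suffix_length_le)
    also have "\<dots> \<le> poly bz (nodes (ea x))" using bz[of x] length_le_nodes[of "zs x" enc_pvar] by simp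
    finally have m: "length ys * poly bB (nodes (ea x)) \<le> poly bz (nodes (ea x)) * poly bB (nodes (ea x))"
      by (rule mult_le_mono1)
    have "nodes (enc_prod enc_config enc_lines (levels ys (c x)))
        = 1 + nodes (enc_config (fst (levels ys (c x)))) + nodes (enc_lines (snd (levels ys (c x))))"
      by (simp add: enc_prod_def)
    moreover have "poly (2 + bC + bz * bB) (nodes (ea x))
        = 2 + poly bC (nodes (ea x)) + poly bz (nodes (ea x)) * poly bB (nodes (ea x))"
      by simp
    ultimately have "nodes (enc_prod enc_config enc_lines (levels ys (c x))) \<le> poly (2 + bC + bz * bB) (nodes (ea x))"
      using lines[OF sub] config[of ys x] m by linarith
    then show "nodes (enc_prod enc_config enc_lines (foldr (\<lambda>z st. (next_rows z (fst st), block z (fst st) @ snd st)) ys (c x, [])))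
        \<le> poly (2 + bC + bz * bB) (nodes (ea x))"
      unfolding levels_def .
  qed (rule polytime_block polytime_next_rows polytime_control zs c)+
qed

lemma polytime_refutation:
  assumes "polytime ea enc_mons fs" "polytime ea enc_mons hs"
  shows "polytime ea enc_lines (\<lambda>x. refutation (fs x) (hs x))"
proof (rule polytime_comp2[where f = refutation, OF _ assms])
  have levels: "polytime (enc_prod enc_mons enc_mons) (enc_prod enc_config enc_lines)
     (\<lambda>p. levels (remdups (concat (snd p))) (initial_rows (normal_clauses (snd p))))"
    by (rule polytime_levels, (rule polytime_initial_rows polytime_normal_clauses polytime_control)+)
       (auto simp: initial_rows_def)
  show "polytime (enc_prod enc_mons enc_mons) enc_lines (\<lambda>p. refutation (fst p) (snd p))"
    unfolding refutation_def
    by (rule levels polytime_weakening_lines polytime_written_rows polytime_final_lines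
        polytime_normal_clauses polytime_control)+
qed

end

text \<open>The expression moves to position 0, where \<open>runs\<close> starts, which shifts all
  other functions by one.\<close>

lemma polytime_runs:
  assumes "polytime ea eb f"
  shows "\<exists>P b. \<forall>x. \<exists>t. runs P (ea x) (eb (f x)) t \<and> t \<le> poly b (nodes (ea x))"
proof -
  obtain P e b where P: "\<And>x. \<exists>t. eval P (ea x) e (eb (f x)) t \<and> t \<le> poly b (nodes (ea x))"
    using assms unfolding polytime_def by blast
  let ?P = "shift 1 e # map (shift 1) P"
  have "\<exists>t. runs ?P (ea x) (eb (f x)) t \<and> t \<le> poly b (nodes (ea x))" for x
    using P[of x] eval_shift[of P "ea x" e "eb (f x)" _ "[shift 1 e]" "[]"] unfolding runs_def by auto
  then show ?thesis by blast
qed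

theorem theorem4p4:
  fixes num :: "'f::{field,finite} \<Rightarrow> nat"
  assumes "inj num"
  shows "\<exists>(P :: program) (b :: nat poly). \<forall>n F H.
           cnf_over n (cnf_of F) \<and> hitting_refutation n (cnf_of F) (cnf_of H) \<longrightarrow>
           (\<exists>(R :: 'f written_refutation) t.
              runs P (enc_input n F H) (enc_refutation num R) t
            \<and> t \<le> poly b (nodes (enc_input n F H))
            \<and> is_ext_pc_refutation n (translate_cnf n (cnf_of F)) R)"
proof -
  define ef where "ef = (\<lambda>c :: 'f. enc_nat (num c))"
  let ?enc_cnf = "enc_list (enc_list enc_literal)"
  let ?enc_in = "enc_prod enc_nat (enc_prod ?enc_cnf ?enc_cnf)"
  let ?enc_lines = "enc_list (enc_list (enc_prod ef (enc_list enc_pvar)))"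
  \<comment> \<open>The list of extension polynomials is empty. The function is total: the
    hypotheses on \<open>F\<close> and \<open>H\<close> enter through correctness, not through the
    running time.\<close>
  define f :: "nat \<times> literal list list \<times> literal list list \<Rightarrow> 'f written_refutation" where
    "f x = ([], refutation (map (map translate_literal) (fst (snd x))) (map (map translate_literal) (snd (snd x))))" for x
  have ef: "inj ef"
    using injD[OF assms] injD[OF inj_enc_nat] unfolding ef_def inj_def by blast
  have "polytime ?enc_in (enc_prod ?enc_lines ?enc_lines) f"
    unfolding f_def
    by (rule polytime_refutation[OF ef] polytime_comp[OF polytime_translate_literal] polytime_control)+
  then obtain P b where P: "\<And>x. \<exists>t. runs P (?enc_in x) (enc_prod ?enc_lines ?enc_lines (f x)) t \<and> t \<le> poly b (nodes (?enc_in x))"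
    using polytime_runs by blast
  have enc: "?enc_in (n, F, H) = enc_input n F H" "enc_prod ?enc_lines ?enc_lines R = enc_refutation num R" for n F H R
    by (auto simp: enc_prod_def[abs_def] enc_input_def enc_refutation_def enc_poly_def[abs_def] ef_def case_prod_unfold)
  show ?thesis
  proof (rule exI[of _ P], rule exI[of _ b], intro allI impI)
    fix n F H
    assume "cnf_over n (cnf_of F) \<and> hitting_refutation n (cnf_of F) (cnf_of H)"
    then have "is_ext_pc_refutation n (translate_cnf n (cnf_of F)) (f (n, F, H))"
      unfolding f_def by (simp add: refutation_correct)
    with P[of "(n, F, H)"]
    show "\<exists>(R :: 'f written_refutation) t. runs P (enc_input n F H) (enc_refutation num R) t
            \<and> t \<le> poly b (nodes (enc_input n F H))
            \<and> is_ext_pc_refutation n (translate_cnf n (cnf_of F)) R"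
      unfolding enc by blast
  qed
qed

end
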